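(* Let $\mathbf{k}$ be a field, let $n\ge 2$, and let $w=(w_1,\dots,w_n)$ be an $n$-tuple of positive integers. Write $[n]=\{1,\dots,n\}$, $|w|=w_1+\cdots+w_n$, and $|w_J|=\sum_{j\in J}w_j$ for $J\subseteq[n]$ (so $|w_\emptyset|=0$). Let $R_w=\bigoplus_{d\ge 0}(R_w)_d$ be the graded ring of $\mathrm{SL}_2$-invariant sections of powers of $\mathcal{O}(w_1,\dots,w_n)$ on $(\mathbb{P}^1)^n$, and let $M_w=(\mathbb{P}^1)^n/\!/\mathrm{SL}_2=\mathrm{Proj}\,R_w$ be the GIT quotient. (1) The Hilbert function $h(d)=\dim_{\mathbf{k}}(R_w)_d$ of $R_w$ is given by $$h(d)=\sum_{\substack{J\subseteq[n]\\ |w_J|<|w|/2}}(-1)^{|J|}\binom{d\left(|w|/2-|w_J|\right)+n-|J|-2}{n-2}$$ if $d|w|$ is even, and $h(d)=0$ otherwise. (2) If $|w|$ is even, then the degree of $M_w$ is $$\frac{1}{n-2}\left(\sum_{\substack{J\subseteq[n]\\ |w_J|<|w|/2}}(-1)^{|J|}\left(|w|/2-|w_J|\right)^{n-3}\left(\sum_{i=0}^{n-3}\bigl(n-|J|-2-i\bigr)\right)\right).$$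
   Context: Let $S=\mathbf{k}[x_1,y_1,\dots,x_n,y_n]$, graded by $\mathbb{N}^n$ with $\deg x_i=\deg y_i=e_i$ (the $i$-th standard basis vector), and let $S_r$ be the graded piece of degree $r\in\mathbb{N}^n$; then $H^0((\mathbb{P}^1)^n,\mathcal{O}(r_1,\dots,r_n))=S_r$. The group $\mathrm{SL}_2$ acts on $S$ through left multiplication on the $2\times n$ matrix with columns $(x_i,y_i)^T$, and this preserves every $S_r$. Invariants are taken with respect to the algebraic group (group scheme) $\mathrm{SL}_2$; for infinite $\mathbf{k}$ this is the same as invariants of $\mathrm{SL}(2,\mathbf{k})$. The ring $R_w$ is $\bigoplus_{d\ge 0}(S_{dw})^{\mathrm{SL}_2}$ with $(R_w)_d=(S_{dw})^{\mathrm{SL}_2}$. The degree of $M_w$ is its degree as a projective variety with homogeneous coordinate ring $R_w$, read off from the Hilbert polynomial of $R_w$. Convention: $\binom{a}{b}=0$ unless $0\le b\le a$.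
   Formalization: Part (2) is stated for n ≥ 3 (for n = 2 the factor 1/(n−2) is undefined) and excludes n ≥ 4 with some w_i = |w|/2, where M_w is a point of degree 1 but the formula gives 0, e.g. w = (3,1,1,1). *)

theory Defs
  imports
    "HOL-Library.Poly_Mapping"
    "HOL-Computational_Algebra.Polynomial"
    "HOL-Analysis.Analysis"
begin

text \<open>Multivariate polynomials over \<open>'a\<close> in variables \<open>'v\<close>: finitely supported functions on
  monomials, with the convolution product of \<open>HOL-Library.Poly_Mapping\<close>.\<close>

type_synonym ('v, 'a) mpoly = "('v \<Rightarrow>\<^sub>0 nat) \<Rightarrow>\<^sub>0 'a"

definition mconst :: "'a::zero \<Rightarrow> ('v, 'a) mpoly" where
  "mconst c = Poly_Mapping.single 0 c"

definition mvar :: "'v \<Rightarrow> ('v, 'a::zero_neq_one) mpoly" where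
  "mvar v = Poly_Mapping.single (Poly_Mapping.single v 1) 1"

definition mscale :: "'a::semiring_0 \<Rightarrow> ('v, 'a) mpoly \<Rightarrow> ('v, 'a) mpoly" where
  "mscale c p = mconst c * p"

text \<open>The homomorphism given by \<open>\<phi>\<close> on coefficients and \<open>g\<close> on variables.\<close>

definition meval :: "('a::zero \<Rightarrow> 'b::comm_semiring_1) \<Rightarrow> ('v \<Rightarrow> 'b) \<Rightarrow> ('v, 'a) mpoly \<Rightarrow> 'b" where
  "meval \<phi> g p = (\<Sum>m\<in>Poly_Mapping.keys p. \<phi> (Poly_Mapping.lookup p m) *
      (\<Prod>v\<in>Poly_Mapping.keys m. g v ^ Poly_Mapping.lookup m v))"

lemma vector_space_mscale:
  "vector_space (mscale :: 'k::field \<Rightarrow> ('v, 'k) mpoly \<Rightarrow> ('v, 'k) mpoly)"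
proof unfold_locales
  fix a b :: 'k and p q :: "('v, 'k) mpoly"
  show "mscale a (p + q) = mscale a p + mscale a q"
    by (simp add: mscale_def distrib_left)
  show "mscale (a + b) p = mscale a p + mscale b p"
    by (simp add: mscale_def mconst_def single_add distrib_right)
  show "mscale a (mscale b p) = mscale (a * b) p"
    by (simp add: mscale_def mconst_def mult_single flip: mult.assoc)
  show "mscale 1 p = p"
    by (simp add: mscale_def mconst_def)
qed

text \<open>The coordinate \<open>X i\<close>, \<open>Y i\<close> is \<open>x\<^sub>i\<close>, \<open>y\<^sub>i\<close>. The polynomial type has variables for all
  \<open>i :: nat\<close>; the ring \<open>S\<close> for \<open>n\<close> points consists of the polynomials in those with
  \<open>i \<in> {1..n}\<close>.\<close>

datatype coord = X nat | Y nat

text \<open>\<open>S_piece n r\<close> is the graded piece \<open>S\<^sub>r\<close>; only the values of \<open>r\<close> on \<open>{1..n}\<close> matter.\<close>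

definition S_piece :: "nat \<Rightarrow> (nat \<Rightarrow> nat) \<Rightarrow> (coord, 'k::zero) mpoly set" where
  "S_piece n r = {f. \<forall>m\<in>Poly_Mapping.keys f.
      Poly_Mapping.keys m \<subseteq> X ` {1..n} \<union> Y ` {1..n} \<and>
      (\<forall>i\<in>{1..n}. Poly_Mapping.lookup m (X i) + Poly_Mapping.lookup m (Y i) = r i)}"

text \<open>Invariants of the group scheme \<open>SL\<^sub>2\<close>. Its coordinate ring is
  \<open>k[a,b,c,d] / (ad - bc - 1)\<close>. The coaction \<open>S \<rightarrow> k[SL\<^sub>2] \<otimes> S\<close> sends
  \<open>x\<^sub>i\<close> to \<open>a x\<^sub>i + b y\<^sub>i\<close> and \<open>y\<^sub>i\<close> to \<open>c x\<^sub>i + d y\<^sub>i\<close>, and \<open>f\<close> is invariant iff the coaction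
  sends it to \<open>1 \<otimes> f\<close>. Here \<open>k[SL\<^sub>2] \<otimes> S\<close> is represented by the polynomials in
  \<open>x\<^sub>i, y\<^sub>i\<close> over \<open>k[a,b,c,d]\<close>, so equality in it is congruence modulo the principal ideal
  \<open>(ad - bc - 1)\<close>. Equivalently, \<open>f\<close> is fixed by \<open>SL\<^sub>2(A)\<close> in \<open>A \<otimes> S\<close> for every commutative
  \<open>k\<close>-algebra \<open>A\<close>; over a finite field this is stronger than being fixed by \<open>SL(2,k)\<close>.\<close>

datatype sl2_entry = Ent_a | Ent_b | Ent_c | Ent_d

fun generic_act :: "coord \<Rightarrow> (coord, (sl2_entry, 'k::comm_ring_1) mpoly) mpoly" where
  "generic_act (X i) = mconst (mvar Ent_a) * mvar (X i) + mconst (mvar Ent_b) * mvar (Y i)"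
| "generic_act (Y i) = mconst (mvar Ent_c) * mvar (X i) + mconst (mvar Ent_d) * mvar (Y i)"

definition coaction ::
    "(coord, 'k::comm_ring_1) mpoly \<Rightarrow> (coord, (sl2_entry, 'k) mpoly) mpoly" where
  "coaction f = meval (\<lambda>c. mconst (mconst c)) generic_act f"

definition coeff_embed ::
    "(coord, 'k::comm_ring_1) mpoly \<Rightarrow> (coord, (sl2_entry, 'k) mpoly) mpoly" where
  "coeff_embed f = meval (\<lambda>c. mconst (mconst c)) mvar f"

definition det_relation :: "(sl2_entry, 'k::comm_ring_1) mpoly" where
  "det_relation = mvar Ent_a * mvar Ent_d - mvar Ent_b * mvar Ent_c - 1"

definition SL2_invariant :: "(coord, 'k::comm_ring_1) mpoly \<Rightarrow> bool" where
  "SL2_invariant f \<longleftrightarrow> mconst det_relation dvd (coaction f - coeff_embed f)"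

definition R_piece :: "nat \<Rightarrow> (nat \<Rightarrow> nat) \<Rightarrow> nat \<Rightarrow> (coord, 'k::comm_ring_1) mpoly set" where
  "R_piece n w d = {f \<in> S_piece n (\<lambda>i. d * w i). SL2_invariant f}"

text \<open>A graded ring enters the next definitions only through its family \<open>R\<close> of graded pieces.\<close>

definition hilbert_function :: "(nat \<Rightarrow> ('v, 'k::field) mpoly set) \<Rightarrow> nat \<Rightarrow> nat" where
  "hilbert_function R d = vector_space.dim mscale (R d)"

definition is_hilbert_polynomial ::
    "(nat \<Rightarrow> ('v, 'k::field) mpoly set) \<Rightarrow> real poly \<Rightarrow> bool" where
  "is_hilbert_polynomial R P \<longleftrightarrow>
    eventually (\<lambda>d. real (hilbert_function R d) = poly P (real d)) sequentially"

definition hilbert_polynomial :: "(nat \<Rightarrow> ('v, 'k::field) mpoly set) \<Rightarrow> real poly" where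
  "hilbert_polynomial R = (THE P. is_hilbert_polynomial R P)"

lemma hilbert_polynomial_eq:
  assumes "is_hilbert_polynomial R P"
  shows "hilbert_polynomial R = P"
  unfolding hilbert_polynomial_def
proof (rule the_equality)
  fix Q assume "is_hilbert_polynomial R Q"
  with assms have "eventually (\<lambda>d. poly (Q - P) (real d) = 0) sequentially"
    unfolding is_hilbert_polynomial_def by eventually_elim simp
  then obtain N where N: "\<And>d. d \<ge> N \<Longrightarrow> poly (Q - P) (real d) = 0"
    by (auto simp: eventually_sequentially)
  have "infinite (real ` {N..})"
    by (simp add: finite_image_iff infinite_Ici)
  moreover have "real ` {N..} \<subseteq> {x. poly (Q - P) x = 0}"
    using N by auto
  ultimately have "infinite {x. poly (Q - P) x = 0}"
    using finite_subset by blast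
  then show "Q = P"
    using poly_roots_finite[of "Q - P"] by auto
qed (fact assms)

text \<open>\<open>r!\<close> times the leading coefficient of the Hilbert polynomial, \<open>r\<close> its degree; it is \<open>0\<close> if
  the Hilbert polynomial vanishes, i.e. if \<open>Proj\<close> is empty.\<close>

definition projective_degree :: "(nat \<Rightarrow> ('v, 'k::field) mpoly set) \<Rightarrow> real" where
  "projective_degree R =
    fact (Polynomial.degree (hilbert_polynomial R)) * lead_coeff (hilbert_polynomial R)"

definition weight :: "(nat \<Rightarrow> nat) \<Rightarrow> nat set \<Rightarrow> nat" where
  "weight w J = (\<Sum>j\<in>J. w j)"

definition short_subsets :: "nat \<Rightarrow> (nat \<Rightarrow> nat) \<Rightarrow> nat set set" where
  "short_subsets n w = {J. J \<subseteq> {1..n} \<and> real (weight w J) < real (weight w {1..n}) / 2}"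

text \<open>The binomial coefficient for an integer \<open>a\<close>, given as a real number, with the convention that
  it is \<open>0\<close> unless \<open>0 \<le> b \<le> a\<close>. The library's \<open>gchoose\<close> is nonzero for negative \<open>a\<close>.\<close>

definition binom :: "real \<Rightarrow> nat \<Rightarrow> real" where
  "binom a b = (if real b \<le> a then a gchoose b else 0)"

definition degree_formula :: "nat \<Rightarrow> (nat \<Rightarrow> nat) \<Rightarrow> real" where
  "degree_formula n w = 1 / (real n - 2) *
    (\<Sum>J\<in>short_subsets n w. (- 1) ^ card J *
      (real (weight w {1..n}) / 2 - real (weight w J)) ^ (n - 3) *
      (\<Sum>i=0..n-3. real n - real (card J) - 2 - real i))"

end

theory Submission
  imports Defs
begin

text \<open>An invariant of weight zero is the same as a polynomial fixed by the shears
  \<open>y\<^sub>i \<mapsto> y\<^sub>i + c x\<^sub>i\<close> whose \<open>x\<close>- and \<open>y\<close>-degrees agree. Take a shear-invariant \<open>f\<close> of arbitrary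
  weight and let \<open>g y\<^sub>n ^ b\<close> be its top term in \<open>y\<^sub>n\<close>. Then \<open>g\<close> is a shear-invariant in one point
  fewer, and \<open>b\<close> is at most the weight of \<open>g\<close>. Conversely each such \<open>g\<close> occurs: it is
  a combination of products of brackets and of coordinates \<open>x\<^sub>i\<close>, and \<open>b\<close> of the factors
  \<open>x\<^sub>i\<close> can be replaced by brackets \<open>[i n]\<close>. This is a characteristic-free Clebsch--Gordan
  filtration; it shows that brackets and \<open>x\<^sub>i\<close> generate, and gives a recursion on \<open>n\<close> for the
  dimensions. The difference of the numbers of monomials of \<open>y\<close>-degree \<open>B\<close> and \<open>B - 1\<close> satisfies
  the same recursion, and inclusion--exclusion over the box evaluates it.

  For the degree, one step of the recursion at the centre of symmetry bounds the degree of the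
  Hilbert polynomial by \<open>n - 3\<close>. If no weight reaches half of the total, restricting
  the recursion to a neighbourhood of an interior path of partial weights gives the growth
  \<open>d ^ (n - 3)\<close>; if one weight exceeds half, the Hilbert function vanishes for \<open>d > 0\<close>.\<close>

section \<open>The evaluation homomorphism\<close>

text \<open>In positive characteristic \<open>SL_2\<close>-modules need not be completely reducible,
  and a finite field has too few rational points; so neither multiplicities of irreducibles nor
  averaging over group elements is available. Every group element used here is generic: the matrix
  entries, the shear parameter and the torus parameter are variables, and invariance is moved by
  substitution into whichever ring a step needs (polynomials over polynomials, Laurent polynomials).
  This is why homomorphisms between changing rings are handled by an explicit predicate. Weight zero
  is not preserved when a point is removed, so the induction on \<open>n\<close> has to run over all
  weights. For the degree there are two obstacles: the summands of the Hilbert function have degree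
  n - 2 in d, one more than the dimension of the quotient, and neither the cancellation of their
  leading terms nor the nonvanishing of the next coefficient can be seen in the alternating
  sum.\<close>

definition is_hom :: "('a::comm_ring_1 \<Rightarrow> 'b::comm_ring_1) \<Rightarrow> bool" where
  "is_hom \<phi> \<longleftrightarrow> \<phi> 1 = 1 \<and> (\<forall>a b. \<phi> (a + b) = \<phi> a + \<phi> b) \<and> (\<forall>a b. \<phi> (a * b) = \<phi> a * \<phi> b)"

lemma is_homI:
  assumes "\<phi> 1 = 1" "\<And>a b. \<phi> (a + b) = \<phi> a + \<phi> b" "\<And>a b. \<phi> (a * b) = \<phi> a * \<phi> b"
  shows "is_hom \<phi>"
  using assms by (simp add: is_hom_def)

lemma is_hom_1: "is_hom \<phi> \<Longrightarrow> \<phi> 1 = 1"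
  and is_hom_add: "is_hom \<phi> \<Longrightarrow> \<phi> (a + b) = \<phi> a + \<phi> b"
  and is_hom_mult: "is_hom \<phi> \<Longrightarrow> \<phi> (a * b) = \<phi> a * \<phi> b"
  by (simp_all add: is_hom_def)

lemma is_hom_0: "is_hom \<phi> \<Longrightarrow> \<phi> 0 = 0"
  using is_hom_add[of \<phi> 0 0] by simp

lemma is_hom_uminus: "is_hom \<phi> \<Longrightarrow> \<phi> (- a) = - \<phi> a"
  using is_hom_add[of \<phi> "- a" a] is_hom_0[of \<phi>] by (simp add: eq_neg_iff_add_eq_0)

lemma is_hom_diff: "is_hom \<phi> \<Longrightarrow> \<phi> (a - b) = \<phi> a - \<phi> b"
  using is_hom_add[of \<phi> a "- b"] is_hom_uminus[of \<phi> b] by simp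

lemma is_hom_power:
  assumes "is_hom \<phi>"
  shows "\<phi> (a ^ k) = \<phi> a ^ k"
  by (induction k) (simp_all add: is_hom_1[OF assms] is_hom_mult[OF assms])

lemma is_hom_sum:
  assumes "is_hom \<phi>"
  shows "\<phi> (sum f A) = (\<Sum>x\<in>A. \<phi> (f x))"
  by (induction A rule: infinite_finite_induct)
    (simp_all add: is_hom_0[OF assms] is_hom_add[OF assms])

lemma is_hom_prod:
  assumes "is_hom \<phi>"
  shows "\<phi> (prod f A) = (\<Prod>x\<in>A. \<phi> (f x))"
  by (induction A rule: infinite_finite_induct)
    (simp_all add: is_hom_1[OF assms] is_hom_mult[OF assms])

lemma is_hom_compose: "is_hom \<phi> \<Longrightarrow> is_hom \<psi> \<Longrightarrow> is_hom (\<lambda>x. \<psi> (\<phi> x))"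
  by (simp add: is_hom_def)

lemmas is_hom_simps = is_hom_0 is_hom_1 is_hom_add is_hom_mult is_hom_uminus is_hom_diff
  is_hom_power is_hom_sum is_hom_prod

lemma is_hom_mconst: "is_hom (mconst :: 'a::comm_ring_1 \<Rightarrow> ('v, 'a) mpoly)"
  by (rule is_homI) (simp_all add: mconst_def single_add mult_single)

lemma is_hom_const_poly: "is_hom (\<lambda>a::'a::comm_ring_1. [:a:])"
  by (rule is_homI) auto

lemma is_hom_poly: "is_hom (\<lambda>p. poly p a)"
  by (rule is_homI) auto

definition meval_mono :: "('v \<Rightarrow> 'b::comm_semiring_1) \<Rightarrow> ('v \<Rightarrow>\<^sub>0 nat) \<Rightarrow> 'b" where
  "meval_mono g m = (\<Prod>v\<in>Poly_Mapping.keys m. g v ^ Poly_Mapping.lookup m v)"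

lemma meval_mono_superset:
  assumes "finite V" "Poly_Mapping.keys m \<subseteq> V"
  shows "meval_mono g m = (\<Prod>v\<in>V. g v ^ Poly_Mapping.lookup m v)"
  unfolding meval_mono_def
  by (rule prod.mono_neutral_left) (use assms in \<open>auto simp: in_keys_iff\<close>)

lemma meval_mono_add: "meval_mono g (m + m') = meval_mono g m * meval_mono g m'"
proof -
  define V where "V = Poly_Mapping.keys m \<union> Poly_Mapping.keys m'"
  have "finite V" "Poly_Mapping.keys (m + m') \<subseteq> V"
    "Poly_Mapping.keys m \<subseteq> V" "Poly_Mapping.keys m' \<subseteq> V"
    using keys_add[of m m'] by (auto simp: V_def)
  then show ?thesis
    by (simp add: meval_mono_superset[of V] lookup_add power_add prod.distrib)
qed

lemma meval_alt:
  "meval \<phi> g p = (\<Sum>m\<in>Poly_Mapping.keys p. \<phi> (Poly_Mapping.lookup p m) * meval_mono g m)"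
  by (simp add: meval_def meval_mono_def)

lemma meval_superset:
  assumes "\<phi> 0 = 0" "finite K" "Poly_Mapping.keys p \<subseteq> K"
  shows "meval \<phi> g p = (\<Sum>m\<in>K. \<phi> (Poly_Mapping.lookup p m) * meval_mono g m)"
  unfolding meval_alt
  by (rule sum.mono_neutral_left) (use assms in \<open>auto simp: in_keys_iff\<close>)

lemma meval_single:
  "is_hom \<phi> \<Longrightarrow> meval \<phi> g (Poly_Mapping.single m c) = \<phi> c * meval_mono g m"
  by (subst meval_superset[of _ "{m}"]) (auto simp: is_hom_0)

lemma meval_add:
  assumes "is_hom \<phi>"
  shows "meval \<phi> g (p + q) = meval \<phi> g p + meval \<phi> g q"
proof -
  define K where "K = Poly_Mapping.keys p \<union> Poly_Mapping.keys q"
  have "finite K" "Poly_Mapping.keys (p + q) \<subseteq> K"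
    "Poly_Mapping.keys p \<subseteq> K" "Poly_Mapping.keys q \<subseteq> K"
    using keys_add[of p q] by (auto simp: K_def)
  then show ?thesis
    by (simp add: meval_superset[of \<phi> K] is_hom_0[OF assms] lookup_add is_hom_add[OF assms]
        distrib_right sum.distrib)
qed

lemma poly_mapping_sum_single:
  "p = (\<Sum>m\<in>Poly_Mapping.keys p. Poly_Mapping.single m (Poly_Mapping.lookup p m))"
  by (rule poly_mapping_eqI) (auto simp: lookup_sum lookup_single when_def in_keys_iff)

lemma poly_mapping_single_induct [case_names zero single add]:
  assumes "P 0" "\<And>m c. P (Poly_Mapping.single m c)" "\<And>p q. P p \<Longrightarrow> P q \<Longrightarrow> P (p + q)"
  shows "P (p :: 'v \<Rightarrow>\<^sub>0 'a::comm_monoid_add)"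
proof -
  have "P (\<Sum>m\<in>K. Poly_Mapping.single m (Poly_Mapping.lookup p m))" if "finite K" for K
    using that by (induction K rule: finite_induct) (simp_all add: assms)
  then show ?thesis
    by (subst poly_mapping_sum_single) simp
qed

lemma meval_mult:
  assumes "is_hom \<phi>"
  shows "meval \<phi> g (p * q) = meval \<phi> g p * meval \<phi> g q"
proof (induction p rule: poly_mapping_single_induct)
  case zero
  show ?case by (simp add: meval_alt)
next
  case (single m c)
  show ?case
  proof (induction q rule: poly_mapping_single_induct)
    case zero
    show ?case by (simp add: meval_alt)
  next
    case (single m' c')
    show ?case
      by (simp add: meval_single[OF assms] mult_single is_hom_mult[OF assms]
          meval_mono_add mult_ac)
  next
    case (add p q)
    then show ?case by (simp add: meval_add[OF assms] distrib_left)
  qed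
next
  case (add p q)
  then show ?case by (simp add: meval_add[OF assms] distrib_right)
qed

lemma meval_mconst: "is_hom \<phi> \<Longrightarrow> meval \<phi> g (mconst c) = \<phi> c"
  by (simp add: mconst_def meval_single meval_mono_def)

lemma meval_mvar: "is_hom \<phi> \<Longrightarrow> meval \<phi> g (mvar v) = g v"
  by (simp add: mvar_def meval_single is_hom_1 meval_mono_def)

lemma mconst_1 [simp]: "mconst 1 = 1"
  by (simp add: mconst_def)

lemma is_hom_meval:
  assumes "is_hom \<phi>"
  shows "is_hom (meval \<phi> g)"
  using meval_mconst[OF assms, of g 1]
  by (intro is_homI) (simp_all add: meval_add[OF assms] meval_mult[OF assms] is_hom_1[OF assms])

lemma meval_compose:
  assumes "is_hom \<psi>"
  shows "\<psi> (meval \<phi> g p) = meval (\<lambda>a. \<psi> (\<phi> a)) (\<lambda>v. \<psi> (g v)) p"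
  by (simp add: meval_def is_hom_simps[OF assms])

lemma meval_mono_mvar: "meval_mono mvar m = Poly_Mapping.single m (1::'a::comm_ring_1)"
proof -
  have pow: "mvar v ^ k = Poly_Mapping.single (Poly_Mapping.single v k) (1::'a)" for v :: 'v and k
    by (induction k) (simp_all add: mvar_def mult_single flip: single_add)
  have "(\<Prod>v\<in>V. mvar v ^ Poly_Mapping.lookup m v) =
      Poly_Mapping.single (\<Sum>v\<in>V. Poly_Mapping.single v (Poly_Mapping.lookup m v)) (1::'a)"
    if "finite V" for V
    using that by (induction V rule: finite_induct) (simp_all add: pow mult_single)
  then show ?thesis
    by (simp add: meval_mono_def flip: poly_mapping_sum_single)
qed

lemma meval_mconst_mvar: "meval mconst mvar p = (p :: ('v, 'a::comm_ring_1) mpoly)"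
proof (induction p rule: poly_mapping_single_induct)
  case (single m c)
  show ?case
    by (simp add: meval_single[OF is_hom_mconst] meval_mono_mvar)
      (simp add: mconst_def mult_single)
next
  case (add p q)
  then show ?case by (simp add: meval_add[OF is_hom_mconst])
qed (simp add: meval_alt)

section \<open>Multigraded pieces\<close>

definition coord_eval :: "(nat \<Rightarrow> 'b) \<Rightarrow> (nat \<Rightarrow> 'b) \<Rightarrow> coord \<Rightarrow> 'b" where
  "coord_eval x y = case_coord x y"

lemma coord_eval_simps [simp]: "coord_eval x y (X i) = x i" "coord_eval x y (Y i) = y i"
  by (simp_all add: coord_eval_def)

text \<open>With \<open>x_i\<close> of torus weight 1 and \<open>y_i\<close> of weight -1, the
  number \<open>B\<close> fixes the torus weight as |r| - 2B.\<close>

definition bipiece :: "nat \<Rightarrow> (nat \<Rightarrow> nat) \<Rightarrow> nat \<Rightarrow> (coord, 'k::zero) mpoly set" where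
  "bipiece n r B = {f \<in> S_piece n r.
     \<forall>m\<in>Poly_Mapping.keys f. (\<Sum>i=1..n. Poly_Mapping.lookup m (Y i)) = B}"

definition mon :: "nat \<Rightarrow> (nat \<Rightarrow> nat) \<Rightarrow> (nat \<Rightarrow> nat) \<Rightarrow> (coord, 'k::comm_ring_1) mpoly" where
  "mon n a b = (\<Prod>i=1..n. mvar (X i) ^ a i * mvar (Y i) ^ b i)"

lemma S_piece_0 [simp]: "0 \<in> S_piece n r"
  by (simp add: S_piece_def)

lemma S_piece_add: "f \<in> S_piece n r \<Longrightarrow> g \<in> S_piece n r \<Longrightarrow> f + g \<in> S_piece n r"
  using keys_add[of f g] unfolding S_piece_def by blast

lemma S_piece_mult:
  assumes "f \<in> S_piece n r" "g \<in> S_piece n s"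
  shows "f * g \<in> S_piece n (\<lambda>i. r i + s i)"
proof -
  have "Poly_Mapping.keys (a + b) \<subseteq> X ` {1..n} \<union> Y ` {1..n} \<and>
      (\<forall>i\<in>{1..n}. Poly_Mapping.lookup (a + b) (X i) + Poly_Mapping.lookup (a + b) (Y i) = r i + s i)"
    if "a \<in> Poly_Mapping.keys f" "b \<in> Poly_Mapping.keys g" for a b
  proof (intro conjI ballI)
    show "Poly_Mapping.keys (a + b) \<subseteq> X ` {1..n} \<union> Y ` {1..n}"
      using that assms keys_add[of a b] unfolding S_piece_def by blast
    fix i assume i: "i \<in> {1..n}"
    have "Poly_Mapping.lookup a (X i) + Poly_Mapping.lookup a (Y i) = r i"
      "Poly_Mapping.lookup b (X i) + Poly_Mapping.lookup b (Y i) = s i"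
      using that assms i by (auto simp: S_piece_def)
    then show "Poly_Mapping.lookup (a + b) (X i) + Poly_Mapping.lookup (a + b) (Y i) = r i + s i"
      by (simp add: lookup_add)
  qed
  then show ?thesis
    using keys_mult[of f g] unfolding S_piece_def by blast
qed

lemma S_piece_cong: "(\<And>i. i \<in> {1..n} \<Longrightarrow> r i = s i) \<Longrightarrow> S_piece n r = S_piece n s"
  by (auto simp: S_piece_def)

lemma bipiece_cong: "(\<And>i. i \<in> {1..n} \<Longrightarrow> r i = s i) \<Longrightarrow> bipiece n r B = bipiece n s B"
  unfolding bipiece_def by (subst S_piece_cong[of n r s]) auto

lemma bipiece_0 [simp]: "0 \<in> bipiece n r B"
  by (simp add: bipiece_def)

lemma bipiece_add: "f \<in> bipiece n r B \<Longrightarrow> g \<in> bipiece n r B \<Longrightarrow> f + g \<in> bipiece n r B"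
  using keys_add[of f g] S_piece_add[of f n r g] by (auto simp: bipiece_def)

lemma bipiece_mult:
  assumes "f \<in> bipiece n r B" "g \<in> bipiece n s C"
  shows "f * g \<in> bipiece n (\<lambda>i. r i + s i) (B + C)"
proof -
  have "(\<Sum>i=1..n. Poly_Mapping.lookup (a + b) (Y i)) = B + C"
    if "a \<in> Poly_Mapping.keys f" "b \<in> Poly_Mapping.keys g" for a b
    using that assms by (simp add: bipiece_def lookup_add sum.distrib)
  then show ?thesis
    using assms S_piece_mult[of f n r g s] keys_mult[of f g] unfolding bipiece_def by blast
qed

lemma bipiece_mconst [simp]: "mconst c \<in> bipiece n (\<lambda>i. 0) 0"
  by (auto simp: bipiece_def S_piece_def mconst_def)

lemma bipiece_1 [simp]: "1 \<in> bipiece n (\<lambda>i. 0) 0"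
  by (simp add: bipiece_def S_piece_def)

lemma bipiece_X:
  "i \<in> {1..n} \<Longrightarrow> mvar (X i) \<in> bipiece n (\<lambda>j. if j = i then 1 else 0) 0"
  by (auto simp: bipiece_def S_piece_def mvar_def lookup_single when_def)

lemma bipiece_Y:
  "i \<in> {1..n} \<Longrightarrow> mvar (Y i) \<in> bipiece n (\<lambda>j. if j = i then 1 else 0) 1"
  by (auto simp: bipiece_def S_piece_def mvar_def lookup_single when_def sum.delta)

lemma bipiece_power:
  "f \<in> bipiece n r B \<Longrightarrow> f ^ k \<in> bipiece n (\<lambda>i. k * r i) (k * B)"
proof (induction k)
  case 0
  show ?case by simp
next
  case (Suc k)
  then show ?case using bipiece_mult[of f n r B "f ^ k"] by simp
qed

lemma bipiece_prod:
  assumes "finite A" "\<And>x. x \<in> A \<Longrightarrow> f x \<in> bipiece n (r x) (B x)"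
  shows "prod f A \<in> bipiece n (\<lambda>i. \<Sum>x\<in>A. r x i) (sum B A)"
  using assms
proof (induction A rule: finite_induct)
  case empty
  show ?case by simp
next
  case (insert x A)
  then show ?case using bipiece_mult[of "f x" n "r x" "B x" "prod f A"] by simp
qed

lemma bipiece_mon:
  assumes "\<And>i. i \<in> {1..n} \<Longrightarrow> a i + b i = r i" "(\<Sum>i=1..n. b i) = B"
  shows "mon n a b \<in> bipiece n r B"
proof -
  have "mon n a b \<in> bipiece n
    (\<lambda>j. \<Sum>i\<in>{1..n}. a i * (if j = i then 1 else 0) + b i * (if j = i then 1 else 0))
    (\<Sum>i=1..n. a i * 0 + b i * 1)"
    unfolding mon_def by (intro bipiece_prod bipiece_mult bipiece_power bipiece_X bipiece_Y) auto
  also have "\<dots> = bipiece n r B"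
    using assms
    by (auto intro!: bipiece_cong simp: sum.distrib if_distrib[of "(*) x" for x] sum.delta' cong: if_cong)
  finally show ?thesis .
qed

lemma meval_mono_coords:
  assumes "Poly_Mapping.keys m \<subseteq> X ` {1..n} \<union> Y ` {1..n}"
  shows "meval_mono g m =
    (\<Prod>i=1..n. g (X i) ^ Poly_Mapping.lookup m (X i) * g (Y i) ^ Poly_Mapping.lookup m (Y i))"
proof -
  have "meval_mono g m = (\<Prod>v\<in>X ` {1..n} \<union> Y ` {1..n}. g v ^ Poly_Mapping.lookup m v)"
    using assms by (intro meval_mono_superset) auto
  also have "\<dots> = (\<Prod>v\<in>X ` {1..n}. g v ^ Poly_Mapping.lookup m v) *
      (\<Prod>v\<in>Y ` {1..n}. g v ^ Poly_Mapping.lookup m v)"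
    by (rule prod.union_disjoint) auto
  finally show ?thesis
    by (simp add: prod.reindex inj_on_def prod.distrib)
qed

text \<open>Reduces additive statements about a piece to scalar multiples of monomials. Membership
  of partial sums is proved along with \<open>P\<close>, because the addition step may use that both
  summands lie in the piece.\<close>

lemma bipiece_induct [consumes 1, case_names zero mon add]:
  fixes f :: "(coord, 'k::comm_ring_1) mpoly"
  assumes f: "f \<in> bipiece n r B" and P0: "P 0"
    and Pmon: "\<And>c a b. (\<And>i. i \<in> {1..n} \<Longrightarrow> a i + b i = r i) \<Longrightarrow> (\<Sum>i=1..n. b i) = B
      \<Longrightarrow> P (mconst c * mon n a b)"
    and Padd: "\<And>f g. f \<in> bipiece n r B \<Longrightarrow> g \<in> bipiece n r B \<Longrightarrow> P f \<Longrightarrow> P g \<Longrightarrow> P (f + g)"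
  shows "P f"
proof -
  have single: "Poly_Mapping.single m (Poly_Mapping.lookup f m) \<in> bipiece n r B \<and>
      P (Poly_Mapping.single m (Poly_Mapping.lookup f m))" if m: "m \<in> Poly_Mapping.keys f" for m
  proof -
    define a where "a i = Poly_Mapping.lookup m (X i)" for i
    define b where "b i = Poly_Mapping.lookup m (Y i)" for i
    have keys: "Poly_Mapping.keys m \<subseteq> X ` {1..n} \<union> Y ` {1..n}"
      and ab: "\<And>i. i \<in> {1..n} \<Longrightarrow> a i + b i = r i" "(\<Sum>i=1..n. b i) = B"
      using f m by (auto simp: bipiece_def S_piece_def a_def b_def)
    have "Poly_Mapping.single m (Poly_Mapping.lookup f m) =
        meval mconst mvar (Poly_Mapping.single m (Poly_Mapping.lookup f m))"
      by (simp add: meval_mconst_mvar)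
    also have "\<dots> = mconst (Poly_Mapping.lookup f m) * mon n a b"
      by (simp add: meval_single[OF is_hom_mconst] meval_mono_coords[OF keys]
          mon_def a_def b_def)
    finally show ?thesis
      using Pmon[of a b] ab bipiece_mult[OF bipiece_mconst bipiece_mon[of n a b r B]] by simp
  qed
  have "(\<Sum>m\<in>K. Poly_Mapping.single m (Poly_Mapping.lookup f m)) \<in> bipiece n r B \<and>
     P (\<Sum>m\<in>K. Poly_Mapping.single m (Poly_Mapping.lookup f m))"
    if "K \<subseteq> Poly_Mapping.keys f" for K
    using finite_subset[OF that finite_keys] that
    by (induction K rule: finite_induct) (auto simp: P0 single intro!: bipiece_add Padd)
  then show ?thesis
    by (subst poly_mapping_sum_single) simp
qed

text \<open>Leaves the substitution free outside {1..n}; this is what lets \<open>X 0\<close> act as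
  an independent parameter.\<close>

lemma meval_cong_S_piece:
  assumes "f \<in> S_piece n r"
    and "\<And>i. i \<in> {1..n} \<Longrightarrow> g (X i) = h (X i)" "\<And>i. i \<in> {1..n} \<Longrightarrow> g (Y i) = h (Y i)"
  shows "meval \<phi> g f = meval \<phi> h f"
  unfolding meval_alt
proof (rule sum.cong[OF refl])
  fix m assume "m \<in> Poly_Mapping.keys f"
  then have "Poly_Mapping.keys m \<subseteq> X ` {1..n} \<union> Y ` {1..n}"
    using assms(1) by (auto simp: S_piece_def)
  then show "\<phi> (Poly_Mapping.lookup f m) * meval_mono g m =
      \<phi> (Poly_Mapping.lookup f m) * meval_mono h m"
    using assms(2,3) by (simp add: meval_mono_coords)
qed

lemma meval_mon:
  "is_hom \<phi> \<Longrightarrow> meval \<phi> g (mon n a b) = (\<Prod>i=1..n. g (X i) ^ a i * g (Y i) ^ b i)"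
  by (simp add: mon_def is_hom_simps[OF is_hom_meval] meval_mvar)

section \<open>Unipotent invariants\<close>

text \<open>The variable \<open>X 0\<close> does not occur in \<open>S_piece n r\<close>; it serves as the generic parameter of
  the unipotent group \<open>y\<^sub>i \<mapsto> y\<^sub>i + c x\<^sub>i\<close>.\<close>

definition shear :: "coord \<Rightarrow> (coord, 'k::comm_ring_1) mpoly" where
  "shear = coord_eval (\<lambda>i. mvar (X i)) (\<lambda>i. mvar (Y i) + mvar (X 0) * mvar (X i))"

text \<open>These are the highest weight vectors of weight |r| - 2B for the unipotent subgroup that
  fixes every \<open>x_i\<close>.\<close>

definition U_invariants :: "nat \<Rightarrow> (nat \<Rightarrow> nat) \<Rightarrow> nat \<Rightarrow> (coord, 'k::comm_ring_1) mpoly set" where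
  "U_invariants n r B = {f \<in> bipiece n r B. meval mconst shear f = f}"

lemma meval_shear_eq:
  assumes f: "f \<in> bipiece n r B" "meval mconst shear f = f" and \<phi>: "is_hom \<phi>"
  shows "meval \<phi> (coord_eval x (\<lambda>i. y i + s * x i)) f = meval \<phi> (coord_eval x y) f"
proof -
  \<comment> \<open>The generic parameter \<open>X 0\<close> is sent to \<open>s\<close>; since
    \<open>f\<close> itself does not contain \<open>X 0\<close>, its own value is
    unaffected.\<close>
  define v where "v = coord_eval (x(0 := s)) y"
  have S: "f \<in> S_piece n r"
    using f by (simp add: bipiece_def)
  have "meval \<phi> v f = meval \<phi> v (meval mconst shear f)"
    by (simp add: f)
  also have "\<dots> = meval \<phi> (\<lambda>u. meval \<phi> v (shear u)) f"
    by (simp add: meval_compose[OF is_hom_meval[OF \<phi>]] meval_mconst[OF \<phi>])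
  also have "\<dots> = meval \<phi> (coord_eval x (\<lambda>i. y i + s * x i)) f"
    by (rule meval_cong_S_piece[OF S])
      (auto simp: shear_def v_def meval_mvar[OF \<phi>] is_hom_simps[OF is_hom_meval[OF \<phi>]])
  also have "meval \<phi> v f = meval \<phi> (coord_eval x y) f"
    by (rule meval_cong_S_piece[OF S]) (auto simp: v_def)
  finally show ?thesis ..
qed

lemma is_hom_const_poly_mconst: "is_hom (\<lambda>a::'a::comm_ring_1. [:mconst a:])"
  by (rule is_hom_compose[OF is_hom_mconst is_hom_const_poly])

text \<open>The coefficient of \<open>x\<^sub>N ^ (r\<^sub>N - b) y\<^sub>N ^ b\<close> in an element of \<open>S\<^sub>r\<close> is read off at \<open>x\<^sub>N = 1\<close>.\<close>

definition last_eval :: "nat \<Rightarrow> coord \<Rightarrow> (coord, 'k::comm_ring_1) mpoly poly" where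
  "last_eval N = coord_eval (\<lambda>i. if i = N then 1 else [:mvar (X i):])
     (\<lambda>i. if i = N then [:0, 1:] else [:mvar (Y i):])"

definition last_coeff :: "nat \<Rightarrow> nat \<Rightarrow> (coord, 'k::comm_ring_1) mpoly \<Rightarrow> (coord, 'k) mpoly" where
  "last_coeff N b f = coeff (meval (\<lambda>a. [:mconst a:]) (last_eval N) f) b"

lemma last_coeff_0 [simp]: "last_coeff N b 0 = 0"
  by (simp add: last_coeff_def meval_alt)

lemma last_coeff_add: "last_coeff N b (f + g) = last_coeff N b f + last_coeff N b g"
  by (simp add: last_coeff_def meval_add[OF is_hom_const_poly_mconst])

lemma last_coeff_diff: "last_coeff N b (f - g) = last_coeff N b f - last_coeff N b g"
  by (simp add: last_coeff_def is_hom_simps[OF is_hom_meval[OF is_hom_const_poly_mconst]])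

lemma last_coeff_mscale: "last_coeff N b (mscale c f) = mscale c (last_coeff N b f)"
  by (simp add: last_coeff_def mscale_def meval_mult[OF is_hom_const_poly_mconst]
      meval_mconst[OF is_hom_const_poly_mconst])

lemma meval_last_eval_S_piece:
  assumes "g \<in> S_piece n r"
  shows "meval (\<lambda>a. [:mconst a:]) (last_eval (Suc n)) g = [:g:]"
proof -
  have "meval (\<lambda>a. [:mconst a:]) (last_eval (Suc n)) g =
      meval (\<lambda>a. [:mconst a:]) (\<lambda>v. [:mvar v:]) g"
    by (rule meval_cong_S_piece[OF assms]) (auto simp: last_eval_def)
  also have "\<dots> = [:meval mconst mvar g:]"
    by (rule meval_compose[OF is_hom_const_poly, symmetric])
  finally show ?thesis
    by (simp add: meval_mconst_mvar)
qed

lemma meval_last_eval_mult: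
  fixes g h :: "(coord, 'k::comm_ring_1) mpoly"
  assumes "g \<in> S_piece n r"
  shows "meval (\<lambda>a. [:mconst a:]) (last_eval (Suc n)) (g * h) =
    smult g (meval (\<lambda>a. [:mconst a:]) (last_eval (Suc n)) h)"
  by (simp add: meval_mult[OF is_hom_const_poly_mconst] meval_last_eval_S_piece[OF assms])

lemma last_coeff_mult_S_piece:
  assumes "g \<in> S_piece n r"
  shows "last_coeff (Suc n) b (g * h) = g * last_coeff (Suc n) b h"
  by (simp add: last_coeff_def meval_last_eval_mult[OF assms])

lemma last_coeff_powers:
  assumes "g \<in> S_piece n r"
  shows "last_coeff (Suc n) b (g * mvar (X (Suc n)) ^ p * mvar (Y (Suc n)) ^ q) =
    (if b = q then g else 0)"
proof -
  have "[:0, 1::(coord, 'a) mpoly:] ^ q = monom 1 q"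
    by (simp add: monom_altdef)
  then show ?thesis
    using last_coeff_mult_S_piece[OF assms, of b "mvar (X (Suc n)) ^ p * mvar (Y (Suc n)) ^ q"]
    by (simp add: mult.assoc last_coeff_def last_eval_def
        is_hom_simps[OF is_hom_meval[OF is_hom_const_poly_mconst]]
        meval_mvar[OF is_hom_const_poly_mconst])
qed

lemma mon_Suc:
  "mon (Suc n) a b = mon n a b * mvar (X (Suc n)) ^ a (Suc n) * mvar (Y (Suc n)) ^ b (Suc n)"
  by (simp add: mon_def mult.assoc)

lemma last_coeff_mon:
  "last_coeff (Suc n) k (mconst c * mon (Suc n) a b) =
    (if k = b (Suc n) then mconst c * mon n a b else 0)"
proof -
  have "mconst c * mon n a b \<in> S_piece n (\<lambda>i. 0 + (a i + b i))"
    using bipiece_mult[OF bipiece_mconst[of c] bipiece_mon[of n a b "\<lambda>i. a i + b i"]]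
    by (auto simp: bipiece_def)
  from last_coeff_powers[OF this, of k "a (Suc n)" "b (Suc n)"] show ?thesis
    by (simp add: mon_Suc mult.assoc)
qed

lemma last_coeff_bipiece:
  assumes "f \<in> bipiece (Suc n) r B" "k \<le> B"
  shows "last_coeff (Suc n) k f \<in> bipiece n r (B - k)"
  using assms(1)
proof (induction rule: bipiece_induct)
  case (mon c a b)
  have "mconst c * mon n a b \<in> bipiece n r (B - k)" if "k = b (Suc n)"
  proof -
    have "mon n a b \<in> bipiece n r (B - k)"
      by (rule bipiece_mon) (use mon that assms(2) in auto)
    from bipiece_mult[OF bipiece_mconst this] show ?thesis by simp
  qed
  then show ?case by (simp add: last_coeff_mon)
qed (auto simp: last_coeff_add bipiece_add)

lemma last_coeff_eq_0:
  assumes "f \<in> bipiece (Suc n) r B" "k > B \<or> k > r (Suc n)"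
  shows "last_coeff (Suc n) k f = 0"
  using assms(1)
proof (induction rule: bipiece_induct)
  case (mon c a b)
  have "b (Suc n) \<le> B" "b (Suc n) \<le> r (Suc n)"
    using mon(1)[of "Suc n"] mon(2) by auto
  then show ?case using assms(2) by (auto simp: last_coeff_mon)
qed (auto simp: last_coeff_add)

text \<open>Setting \<open>x_N = 1\<close> loses nothing: by homogeneity the exponent of
  \<open>x_N\<close> is recovered as \<open>r_N - b\<close>.\<close>

lemma last_coeff_expansion:
  assumes "f \<in> bipiece (Suc n) r B"
  shows "f = (\<Sum>b\<le>r (Suc n). last_coeff (Suc n) b f *
    mvar (X (Suc n)) ^ (r (Suc n) - b) * mvar (Y (Suc n)) ^ b)"
  using assms
proof (induction rule: bipiece_induct)
  case (mon c a b)
  have ab: "a (Suc n) + b (Suc n) = r (Suc n)"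
    using mon(1)[of "Suc n"] by simp
  have "(\<Sum>k\<le>r (Suc n). last_coeff (Suc n) k (mconst c * mon (Suc n) a b) *
      mvar (X (Suc n)) ^ (r (Suc n) - k) * mvar (Y (Suc n)) ^ k) =
    (\<Sum>k\<le>r (Suc n). if k = b (Suc n) then mconst c * mon (Suc n) a b else 0)"
    unfolding last_coeff_mon by (rule sum.cong) (auto simp: mon_Suc mult.assoc ab[symmetric])
  also have "\<dots> = mconst c * mon (Suc n) a b"
    using ab by (simp add: sum.delta')
  finally show ?case ..
qed (auto simp: last_coeff_add distrib_right sum.distrib)

section \<open>Top coefficients of unipotent invariants\<close>

lemma U_invariantsD: "f \<in> U_invariants n r B \<Longrightarrow> f \<in> bipiece n r B"
  by (simp add: U_invariants_def)

lemma last_coeff_expansion_top: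
  assumes "f \<in> bipiece (Suc n) r B" "j \<le> r (Suc n)" "\<And>b. b > j \<Longrightarrow> last_coeff (Suc n) b f = 0"
  shows "f = (\<Sum>b\<le>j. last_coeff (Suc n) b f *
    mvar (X (Suc n)) ^ (r (Suc n) - b) * mvar (Y (Suc n)) ^ b)"
proof -
  have "(\<Sum>b\<le>r (Suc n). last_coeff (Suc n) b f *
    mvar (X (Suc n)) ^ (r (Suc n) - b) * mvar (Y (Suc n)) ^ b) = (\<Sum>b\<le>j. last_coeff (Suc n) b f *
    mvar (X (Suc n)) ^ (r (Suc n) - b) * mvar (Y (Suc n)) ^ b)"
    by (rule sum.mono_neutral_right) (use assms in auto)
  then show ?thesis using last_coeff_expansion[OF assms(1)] by simp
qed

text \<open>At \<open>x_N = 1\<close>, \<open>y_N = t\<close> the shear with parameter c turns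
  \<open>t ^ b\<close> into \<open>(t + c) ^ b\<close>. Terms with b < j have degree less than j in
  t, and the term b = j contributes its sheared coefficient with factor 1. Comparing the
  coefficients of \<open>t ^ j\<close> before and after the shear gives the invariance.\<close>

lemma top_last_coeff_U_invariant:
  assumes f: "f \<in> U_invariants (Suc n) r B" and j: "j \<le> B" "j \<le> r (Suc n)"
    and top: "\<And>b. b > j \<Longrightarrow> last_coeff (Suc n) b f = 0"
  shows "last_coeff (Suc n) j f \<in> U_invariants n r (B - j)"
proof -
  let ?pc = "\<lambda>a::'a. [:mconst a:] :: (coord, 'a) mpoly poly"
  note hom = is_hom_meval[OF is_hom_const_poly_mconst]
  have f': "f \<in> bipiece (Suc n) r B" "meval mconst shear f = f"
    using f by (auto simp: U_invariants_def)
  define x where "x i = (if i = Suc n then 1 else [:mvar (X i):] :: (coord, 'a) mpoly poly)" for i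
  define y where "y i = (if i = Suc n then [:0, 1:] else [:mvar (Y i):] :: (coord, 'a) mpoly poly)" for i
  define v where "v = coord_eval x (\<lambda>i. y i + [:mvar (X 0):] * x i)"
  have "meval ?pc v f = meval ?pc (last_eval (Suc n)) f"
    using meval_shear_eq[OF f' is_hom_const_poly_mconst, of x y "[:mvar (X 0):]"]
    by (simp add: v_def last_eval_def x_def[abs_def] y_def[abs_def])
  then have eq: "coeff (meval ?pc v f) j = last_coeff (Suc n) j f"
    by (simp add: last_coeff_def)
  have v_g: "meval ?pc v g = [:meval mconst shear g:]" if "g \<in> S_piece n r" for g
  proof -
    have "meval ?pc v g = meval ?pc (\<lambda>u. [:shear u:]) g"
      by (rule meval_cong_S_piece[OF that]) (auto simp: v_def x_def y_def shear_def)
    also have "\<dots> = [:meval mconst shear g:]"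
      by (rule meval_compose[OF is_hom_const_poly, symmetric])
    finally show ?thesis .
  qed
  have v_N: "v (X (Suc n)) = 1" "v (Y (Suc n)) = [:mvar (X 0), 1:]"
    by (simp_all add: v_def x_def y_def)
  have "meval ?pc v f = (\<Sum>b\<le>j. meval ?pc v (last_coeff (Suc n) b f) * [:mvar (X 0), 1:] ^ b)"
    by (subst last_coeff_expansion_top[OF f'(1) j(2) top])
      (simp_all add: is_hom_simps[OF hom] meval_mvar[OF is_hom_const_poly_mconst] v_N)
  also have "\<dots> = (\<Sum>b\<le>j. smult (meval mconst shear (last_coeff (Suc n) b f)) ([:mvar (X 0), 1:] ^ b))"
  proof (rule sum.cong[OF refl])
    fix b assume "b \<in> {..j}"
    then have "last_coeff (Suc n) b f \<in> S_piece n r"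
      using last_coeff_bipiece[OF f'(1), of b] j by (auto simp: bipiece_def)
    then show "meval ?pc v (last_coeff (Suc n) b f) * [:mvar (X 0), 1:] ^ b =
        smult (meval mconst shear (last_coeff (Suc n) b f)) ([:mvar (X 0), 1:] ^ b)"
      by (simp add: v_g)
  qed
  finally have "coeff (meval ?pc v f) j =
      (\<Sum>b\<le>j. meval mconst shear (last_coeff (Suc n) b f) * coeff ([:mvar (X 0), 1:] ^ b) j)"
    by (simp add: coeff_sum)
  also have "\<dots> = (\<Sum>b\<le>j. if b = j then meval mconst shear (last_coeff (Suc n) j f) else 0)"
  proof (rule sum.cong[OF refl])
    fix b assume b: "b \<in> {..j}"
    have "degree ([:mvar (X 0), 1 :: (coord, 'a) mpoly:] ^ b) \<le> b"
      using degree_power_le[of "[:mvar (X 0), 1 :: (coord, 'a) mpoly:]" b] by simp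
    then have "coeff ([:mvar (X 0), 1 :: (coord, 'a) mpoly:] ^ b) j = 0" if "b < j"
      using that by (intro coeff_eq_0) simp
    moreover have "coeff ([:mvar (X 0), 1 :: (coord, 'a) mpoly:] ^ j) j = 1"
      using coeff_linear_power[of "mvar (X 0) :: (coord, 'a) mpoly" j] by simp
    ultimately show "meval mconst shear (last_coeff (Suc n) b f) * coeff ([:mvar (X 0), 1:] ^ b) j =
        (if b = j then meval mconst shear (last_coeff (Suc n) j f) else 0)"
      using b by auto
  qed
  finally have "meval mconst shear (last_coeff (Suc n) j f) = last_coeff (Suc n) j f"
    by (simp add: eq)
  then show ?thesis
    using last_coeff_bipiece[OF f'(1) j(1)] by (simp add: U_invariants_def)
qed

text \<open>Evaluate \<open>f\<close> at \<open>x\<^sub>i = z\<^sub>i - e y\<^sub>i\<close>, \<open>y\<^sub>i = z\<^sub>i\<close> for \<open>i \<le> n\<close> and at \<open>(1, 0)\<close> for the last point.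
  The degree in \<open>e\<close> is at most the \<open>x\<close>-degree of \<open>f\<close>. The shear with \<open>c = -1\<close> turns the points
  into \<open>(z\<^sub>i - e y\<^sub>i, e y\<^sub>i)\<close> and \<open>(1, -1)\<close>, where the coefficient of \<open>e ^ (B - j)\<close> is the top
  coefficient of \<open>f\<close> up to sign.\<close>

lemma top_last_coeff_bound:
  assumes f: "f \<in> U_invariants (Suc n) r B" and j: "j \<le> r (Suc n)"
    and top: "\<And>b. b > j \<Longrightarrow> last_coeff (Suc n) b f = 0" and nz: "last_coeff (Suc n) j f \<noteq> 0"
  shows "2 * B \<le> (\<Sum>i=1..n. r i) + j"
proof -
  let ?pc = "\<lambda>a::'a. [:mconst a:] :: (coord, 'a) mpoly poly"
  note pc = is_hom_const_poly_mconst
  note hom = is_hom_meval[OF is_hom_const_poly_mconst]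
  have f': "f \<in> bipiece (Suc n) r B" "meval mconst shear f = f"
    using f by (auto simp: U_invariants_def)
  have jB: "j \<le> B"
    using last_coeff_eq_0[OF f'(1), of j] nz by force
  \<comment> \<open>What the text above calls \<open>z_i\<close> is the variable
    \<open>mvar (X i)\<close>, and e is the polynomial variable. The function \<open>z\<close> is
    the second coordinate after the shear, that is \<open>e y_i\<close>, and -1 at the last
    point.\<close>
  define x where "x i = (if i = Suc n then 1 else [:mvar (X i), - mvar (Y i):] :: (coord, 'a) mpoly poly)" for i
  define y where "y i = (if i = Suc n then 0 else [:mvar (X i):] :: (coord, 'a) mpoly poly)" for i
  define z where "z i = (if i = Suc n then - 1 else [:0, mvar (Y i):] :: (coord, 'a) mpoly poly)" for i
  have z: "z = (\<lambda>i. y i + (- 1) * x i)"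
    by (rule ext) (simp add: x_def y_def z_def one_pCons)
  have eq: "meval ?pc (coord_eval x z) f = meval ?pc (coord_eval x y) f"
    unfolding z by (rule meval_shear_eq[OF f' pc])
  \<comment> \<open>The last point (1, 0) kills each monomial that contains its \<open>y\<close>.
    The others have \<open>x\<close>-degree |r| - B in the first \<open>n\<close> points, and e
    enters only through these \<open>x_i\<close>.\<close>
  have low: "coeff (meval ?pc (coord_eval x y) h) k = 0"
    if "h \<in> bipiece (Suc n) r B" and k: "k + B > (\<Sum>i=1..n. r i)" for h k
    using that(1)
  proof (induction rule: bipiece_induct)
    case zero
    then show ?case by (simp add: is_hom_0[OF hom])
  next
    case (add f g)
    then show ?case by (simp add: is_hom_add[OF hom])
  next
    case (mon c a b)
    let ?P = "\<Prod>i=1..n. x i ^ a i * y i ^ b i"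
    have val: "meval ?pc (coord_eval x y) (mconst c * mon (Suc n) a b) =
        smult (mconst c) (?P * (x (Suc n) ^ a (Suc n) * y (Suc n) ^ b (Suc n)))"
      by (simp add: is_hom_mult[OF hom] meval_mon[OF pc] meval_mconst[OF pc])
    show ?case
    proof (cases "b (Suc n) = 0")
      case False
      then show ?thesis by (simp add: val y_def[of "Suc n"] zero_power)
    next
      case True
      have "degree (x i ^ a i * y i ^ b i) \<le> a i" if "i \<in> {1..n}" for i
      proof -
        have "degree (x i ^ a i * y i ^ b i) \<le> degree (x i ^ a i) + degree (y i ^ b i)"
          by (rule degree_mult_le)
        also have "\<dots> \<le> degree (x i) * a i + degree (y i) * b i"
          by (intro add_mono degree_power_le)
        also have "\<dots> \<le> a i"
          using that by (auto simp: x_def y_def)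
        finally show ?thesis .
      qed
      then have "degree ?P \<le> (\<Sum>i=1..n. a i)"
        using degree_prod_sum_le[of "{1..n}" "\<lambda>i. x i ^ a i * y i ^ b i"]
        by (force intro: order_trans sum_mono)
      moreover have "(\<Sum>i=1..n. r i) = (\<Sum>i=1..n. a i + b i)"
        by (rule sum.cong[OF refl]) (use mon(1) in simp)
      then have "(\<Sum>i=1..n. a i) + B = (\<Sum>i=1..n. r i)"
        using mon(2) True by (simp add: sum.distrib)
      ultimately have "degree ?P < k"
        using k by linarith
      then show ?thesis
        using True by (simp add: val x_def[of "Suc n"] coeff_eq_0)
    qed
  qed
  \<comment> \<open>Each factor \<open>e y_i\<close> contributes one e, so \<open>e ^ C\<close>
    splits off; the cofactor \<open>W\<close> at e = 0 is the original monomial.\<close>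
  have high: "coeff (meval ?pc (coord_eval x z) g) k = (if k = C then g else 0)"
    if "g \<in> bipiece n r C" and k: "k \<le> C" for g C k
    using that(1)
  proof (induction rule: bipiece_induct)
    case zero
    then show ?case by (simp add: is_hom_0[OF hom])
  next
    case (add f g)
    then show ?case by (simp add: is_hom_add[OF hom])
  next
    case (mon c a b)
    define W :: "(coord, 'a) mpoly poly"
      where "W = (\<Prod>i=1..n. [:mvar (X i), - mvar (Y i):] ^ a i * [:mvar (Y i):] ^ b i)"
    have "meval ?pc (coord_eval x z) (mon n a b) =
        (\<Prod>i=1..n. monom 1 (b i) * ([:mvar (X i), - mvar (Y i):] ^ a i * [:mvar (Y i):] ^ b i))"
      unfolding meval_mon[OF pc]
    proof (rule prod.cong[OF refl])
      fix i assume i: "i \<in> {1..n}"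
      have zi: "z i = [:0, 1:] * [:mvar (Y i):]"
        using i by (simp add: z_def)
      then have "z i ^ b i = monom 1 (b i) * [:mvar (Y i):] ^ b i"
        by (simp only: zi power_mult_distrib monom_altdef smult_1_left)
      then show "coord_eval x z (X i) ^ a i * coord_eval x z (Y i) ^ b i =
          monom 1 (b i) * ([:mvar (X i), - mvar (Y i):] ^ a i * [:mvar (Y i):] ^ b i)"
        using i by (simp add: x_def mult_ac)
    qed
    also have "\<dots> = [:0, 1:] ^ C * W"
      using mon(2) by (simp add: prod.distrib W_def monom_altdef flip: power_sum)
    finally have val: "meval ?pc (coord_eval x z) (mon n a b) = monom 1 C * W"
      by (simp add: monom_altdef)
    have "coeff W 0 = mon n a b"
      unfolding poly_0_coeff_0[symmetric] W_def mon_def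
      by (simp add: is_hom_simps[OF is_hom_poly])
    then show ?case
      using k by (auto simp: val is_hom_mult[OF hom] meval_mconst[OF pc] coeff_monom_mult)
  qed
  have "meval ?pc (coord_eval x z) f =
      (\<Sum>b\<le>j. meval ?pc (coord_eval x z) (last_coeff (Suc n) b f) * (- 1) ^ b)"
    by (subst last_coeff_expansion_top[OF f'(1) j top])
      (simp_all add: is_hom_simps[OF hom] meval_mvar[OF pc] x_def z_def)
  \<comment> \<open>The term with index b starts at order B - b in e, and B - b exceeds B - j for b
    < j. So only b = j is seen, with the sign from the value -1 at the last point.\<close>
  also have "coeff \<dots> (B - j) = (\<Sum>b\<le>j. if b = j then (- 1) ^ j * last_coeff (Suc n) j f else 0)"
    unfolding coeff_sum
  proof (rule sum.cong[OF refl])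
    fix b assume b: "b \<in> {..j}"
    have "coeff (meval ?pc (coord_eval x z) (last_coeff (Suc n) b f)) (B - j) =
        (if B - j = B - b then last_coeff (Suc n) b f else 0)"
      by (rule high[OF last_coeff_bipiece[OF f'(1)]]) (use b jB in auto)
    moreover have "B - j = B - b \<longleftrightarrow> b = j"
      using b jB by auto
    ultimately show "coeff (meval ?pc (coord_eval x z) (last_coeff (Suc n) b f) * (- 1) ^ b) (B - j) =
        (if b = j then (- 1) ^ j * last_coeff (Suc n) j f else 0)"
      by (cases "even b") auto
  qed
  also have "\<dots> = (- 1) ^ j * last_coeff (Suc n) j f"
    by simp
  finally have "coeff (meval ?pc (coord_eval x y) f) (B - j) \<noteq> 0"
    using nz by (cases "even j") (simp_all add: eq)
  then have "\<not> B - j + B > (\<Sum>i=1..n. r i)"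
    using low[OF f'(1)] by blast
  then show ?thesis
    using jB by linarith
qed

section \<open>Invariants of the group scheme\<close>

lemma is_hom_const2: "is_hom (\<lambda>c::'k::comm_ring_1. mconst (mconst c) :: (coord, (sl2_entry, 'k) mpoly) mpoly)"
  by (rule is_hom_compose[OF is_hom_mconst is_hom_mconst])

lemma is_hom_coaction: "is_hom coaction"
  using is_hom_meval[OF is_hom_const2, of generic_act]
  by (simp add: coaction_def[abs_def])

lemma is_hom_coeff_embed: "is_hom coeff_embed"
  using is_hom_meval[OF is_hom_const2, of mvar]
  by (simp add: coeff_embed_def[abs_def])

lemma SL2_invariant_mconst: "SL2_invariant (mconst c)"
  by (simp add: SL2_invariant_def coaction_def coeff_embed_def meval_mconst[OF is_hom_const2])

lemma SL2_invariant_add: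
  assumes "SL2_invariant f" "SL2_invariant g"
  shows "SL2_invariant (f + g)"
proof -
  have "coaction (f + g) - coeff_embed (f + g) =
      (coaction f - coeff_embed f) + (coaction g - coeff_embed g)"
    by (simp add: is_hom_add[OF is_hom_coaction] is_hom_add[OF is_hom_coeff_embed])
  then show ?thesis
    using assms unfolding SL2_invariant_def by (metis dvd_add)
qed

lemma SL2_invariant_mult:
  assumes "SL2_invariant f" "SL2_invariant g"
  shows "SL2_invariant (f * g)"
proof -
  have "coaction (f * g) - coeff_embed (f * g) =
      (coaction f - coeff_embed f) * coaction g + coeff_embed f * (coaction g - coeff_embed g)"
    by (simp add: is_hom_mult[OF is_hom_coaction] is_hom_mult[OF is_hom_coeff_embed] algebra_simps)
  then show ?thesis
    using assms unfolding SL2_invariant_def by (metis dvd_add dvd_mult dvd_mult2)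
qed

lemma SL2_invariant_1: "SL2_invariant 1"
  using SL2_invariant_mconst[of 1] by simp

section \<open>Brackets, and specialisation to subgroups\<close>

definition bracket :: "nat \<Rightarrow> nat \<Rightarrow> (coord, 'k::comm_ring_1) mpoly" where
  "bracket i j = mvar (X i) * mvar (Y j) - mvar (X j) * mvar (Y i)"

text \<open>A bracket is a 2 by 2 minor, so the coaction multiplies it by ad - bc; the difference is
  (ad - bc - 1) times the bracket.\<close>

lemma SL2_invariant_bracket:
  "SL2_invariant (bracket i j :: (coord, 'k::comm_ring_1) mpoly)"
proof -
  have "coaction (bracket i j :: (coord, 'k) mpoly) - coeff_embed (bracket i j) =
      mconst det_relation * coeff_embed (bracket i j)"
    by (simp add: bracket_def is_hom_simps[OF is_hom_coaction] is_hom_simps[OF is_hom_coeff_embed])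
      (simp add: coaction_def coeff_embed_def meval_mvar[OF is_hom_const2] det_relation_def
        is_hom_add[OF is_hom_mconst]
        is_hom_diff[OF is_hom_mconst] is_hom_mult[OF is_hom_mconst] algebra_simps)
  then show ?thesis
    by (simp add: SL2_invariant_def)
qed

lemma SL2_invariant_prod_list:
  "(\<And>x. x \<in> set xs \<Longrightarrow> SL2_invariant (f x)) \<Longrightarrow> SL2_invariant (prod_list (map f xs))"
  by (induction xs) (simp_all add: SL2_invariant_1 SL2_invariant_mult)

text \<open>A homomorphism killing \<open>det_relation\<close> is a point of the group scheme with
  values in the target ring, and the universal identity can be evaluated there.\<close>

lemma SL2_invariant_specialise:
  fixes f :: "(coord, 'k::comm_ring_1) mpoly"
  assumes f: "SL2_invariant f" and \<psi>: "is_hom \<psi>" and det: "\<psi> det_relation = 0"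
  shows "meval \<psi> h (coaction f) = meval \<psi> h (coeff_embed f)"
proof -
  obtain q where "coaction f - coeff_embed f = mconst det_relation * q"
    using f by (auto simp: SL2_invariant_def dvd_def)
  then have "meval \<psi> h (coaction f - coeff_embed f) = 0"
    by (simp add: meval_mult[OF \<psi>] meval_mconst[OF \<psi>] det)
  then show ?thesis
    by (simp add: is_hom_diff[OF is_hom_meval[OF \<psi>]])
qed

text \<open>Specialises to the lower triangular matrix with ones on the diagonal and the variable
  \<open>X 0\<close> below it; a variable entry keeps the statement strong over finite
  fields.\<close>

lemma SL2_invariant_shear:
  fixes f :: "(coord, 'k::comm_ring_1) mpoly"
  assumes "SL2_invariant f"
  shows "meval mconst shear f = f"
proof -
  define g :: "sl2_entry \<Rightarrow> (coord, 'k) mpoly"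
    where "g v = (case v of Ent_a \<Rightarrow> 1 | Ent_b \<Rightarrow> 0 | Ent_c \<Rightarrow> mvar (X 0) | Ent_d \<Rightarrow> 1)" for v
  define \<psi> where "\<psi> = meval mconst g"
  have \<psi>: "is_hom \<psi>"
    unfolding \<psi>_def by (rule is_hom_meval[OF is_hom_mconst])
  have \<psi>_simps: "\<psi> (mvar v) = g v" "\<psi> (mconst c) = mconst c" for v c
    by (simp_all add: \<psi>_def meval_mvar[OF is_hom_mconst] meval_mconst[OF is_hom_mconst])
  have "\<psi> det_relation = 0"
    by (simp add: det_relation_def is_hom_simps[OF \<psi>] \<psi>_simps g_def)
  from SL2_invariant_specialise[OF assms \<psi> this, of mvar]
  have "meval mconst (\<lambda>v. meval \<psi> mvar (generic_act v)) f = meval mconst mvar f"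
    by (simp add: coaction_def coeff_embed_def meval_compose[OF is_hom_meval[OF \<psi>]]
        meval_mconst[OF \<psi>] meval_mvar[OF \<psi>] \<psi>_simps)
  moreover have "meval \<psi> mvar (generic_act v) = shear v" for v
    by (cases v)
      (simp_all add: is_hom_simps[OF is_hom_meval[OF \<psi>]] meval_mconst[OF \<psi>] meval_mvar[OF \<psi>]
        \<psi>_simps g_def shear_def)
  ultimately show ?thesis
    by (simp add: meval_mconst_mvar)
qed

text \<open>The torus acts through Laurent polynomials in one variable, represented by the group ring
  \<open>int \<Rightarrow>\<^sub>0 'k\<close>.\<close>

lemma SL2_invariant_torus:
  fixes f :: "(coord, 'k::comm_ring_1) mpoly"
  assumes inv: "SL2_invariant f" and f: "f \<in> S_piece n r" and m: "m \<in> Poly_Mapping.keys f"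
  shows "2 * (\<Sum>i=1..n. Poly_Mapping.lookup m (Y i)) = (\<Sum>i=1..n. r i)"
proof -
  define c0 where "c0 = (\<lambda>c::'k. Poly_Mapping.single (0::int) c)"
  define sg :: "coord \<Rightarrow> int" where "sg = coord_eval (\<lambda>i. 1) (\<lambda>i. - 1)"
  define wt where "wt m = (\<Sum>v\<in>Poly_Mapping.keys m. int (Poly_Mapping.lookup m v) * sg v)" for m
  \<comment> \<open>The matrix diag(t, 1/t), where t is the group ring element of exponent
    1.\<close>
  define g :: "sl2_entry \<Rightarrow> int \<Rightarrow>\<^sub>0 'k"
    where "g v = (case v of Ent_a \<Rightarrow> Poly_Mapping.single 1 1 | Ent_b \<Rightarrow> 0 | Ent_c \<Rightarrow> 0
      | Ent_d \<Rightarrow> Poly_Mapping.single (- 1) 1)" for v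
  have c0: "is_hom c0"
    by (rule is_homI) (simp_all add: c0_def single_add mult_single)
  define \<psi>0 where "\<psi>0 = meval c0 g"
  have \<psi>0: "is_hom \<psi>0"
    unfolding \<psi>0_def by (rule is_hom_meval[OF c0])
  define \<psi> :: "(sl2_entry, 'k) mpoly \<Rightarrow> (coord, int \<Rightarrow>\<^sub>0 'k) mpoly" where "\<psi> = (\<lambda>p. mconst (\<psi>0 p))"
  have \<psi>: "is_hom \<psi>"
    unfolding \<psi>_def by (rule is_hom_compose[OF \<psi>0 is_hom_mconst])
  have \<psi>_simps: "\<psi> (mvar v) = mconst (g v)" "\<psi> (mconst c) = mconst (c0 c)" for v c
    by (simp_all add: \<psi>_def \<psi>0_def meval_mvar[OF c0] meval_mconst[OF c0])
  have "\<psi>0 det_relation = 0"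
    by (simp add: det_relation_def is_hom_simps[OF \<psi>0])
      (simp add: \<psi>0_def meval_mvar[OF c0] g_def mult_single)
  then have "\<psi> det_relation = 0"
    by (simp add: \<psi>_def is_hom_0[OF is_hom_mconst])
  note spec = SL2_invariant_specialise[OF inv \<psi> this, of mvar]
  define t :: "coord \<Rightarrow> int \<Rightarrow>\<^sub>0 'k" where "t v = Poly_Mapping.single (sg v) 1" for v
  have act: "meval \<psi> mvar (generic_act v) = mconst (t v) * mvar v" for v
    by (cases v)
      (simp_all add: is_hom_simps[OF is_hom_meval[OF \<psi>]] meval_mconst[OF \<psi>] meval_mvar[OF \<psi>]
        \<psi>_simps g_def t_def sg_def is_hom_0[OF is_hom_mconst])
  have hom: "is_hom (\<lambda>c. mconst (c0 c) :: (coord, int \<Rightarrow>\<^sub>0 'k) mpoly)"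
    by (rule is_hom_compose[OF c0 is_hom_mconst])
  have t_pow: "t v ^ k = Poly_Mapping.single (int k * sg v) 1" for v k
    by (induction k) (simp_all add: t_def mult_single algebra_simps)
  have t_prod: "(\<Prod>v\<in>V. t v ^ Poly_Mapping.lookup m v) =
      Poly_Mapping.single (\<Sum>v\<in>V. int (Poly_Mapping.lookup m v) * sg v) 1" if "finite V" for V m
    using that by (induction V rule: finite_induct) (simp_all add: t_pow mult_single)
  have mono: "meval_mono (\<lambda>v. mconst (t v) * mvar v) m =
      Poly_Mapping.single m (Poly_Mapping.single (wt m) (1::'k))" for m
  proof -
    have "meval_mono (\<lambda>v. mconst (t v) * mvar v) m = mconst (meval_mono t m) * meval_mono mvar m"
      by (simp add: meval_mono_def power_mult_distrib prod.distrib is_hom_prod[OF is_hom_mconst]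
          is_hom_power[OF is_hom_mconst])
    then show ?thesis
      unfolding meval_mono_mvar by (simp add: meval_mono_def t_prod wt_def mconst_def mult_single)
  qed
  have lookup1: "Poly_Mapping.lookup (meval (\<lambda>c. mconst (c0 c)) (\<lambda>v. mconst (t v) * mvar v) p) m =
      Poly_Mapping.single (wt m) (Poly_Mapping.lookup p m)" for p :: "(coord, 'k) mpoly" and m
  proof (induction p rule: poly_mapping_single_induct)
    case (single m' c)
    show ?case
      by (simp add: meval_single[OF hom] mono)
        (simp add: mconst_def c0_def mult_single lookup_single when_def)
  next
    case (add p q)
    then show ?case by (simp add: meval_add[OF hom] lookup_add single_add)
  qed (simp add: meval_alt)
  have lookup2: "Poly_Mapping.lookup (meval (\<lambda>c. mconst (c0 c)) mvar p) m =
      Poly_Mapping.single 0 (Poly_Mapping.lookup p m)" for p :: "(coord, 'k) mpoly" and m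
  proof (induction p rule: poly_mapping_single_induct)
    case (single m' c)
    show ?case
      by (simp add: meval_single[OF hom] meval_mono_mvar)
        (simp add: mconst_def c0_def mult_single lookup_single when_def)
  next
    case (add p q)
    then show ?case by (simp add: meval_add[OF hom] lookup_add single_add)
  qed (simp add: meval_alt)
  from spec have "meval (\<lambda>c. mconst (c0 c)) (\<lambda>v. mconst (t v) * mvar v) f =
      meval (\<lambda>c. mconst (c0 c)) mvar f"
    by (simp add: coaction_def coeff_embed_def meval_compose[OF is_hom_meval[OF \<psi>]]
        meval_mconst[OF \<psi>] meval_mvar[OF \<psi>] \<psi>_simps act)
  then have "Poly_Mapping.single (wt m) (Poly_Mapping.lookup f m) =
      Poly_Mapping.single 0 (Poly_Mapping.lookup f m)"
    unfolding lookup1[symmetric] lookup2[symmetric] by simp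
  \<comment> \<open>Compare the coefficients at exponent 0: the right-hand side is nonzero because
    \<open>m\<close> occurs in \<open>f\<close>, and the left-hand side is nonzero only if
    \<open>wt m = 0\<close>.\<close>
  then have "Poly_Mapping.lookup (Poly_Mapping.single (wt m) (Poly_Mapping.lookup f m)) 0 =
      Poly_Mapping.lookup f m"
    by simp
  then have wt0: "wt m = 0"
    using m by (auto simp: lookup_single when_def in_keys_iff split: if_splits)
  have keys: "Poly_Mapping.keys m \<subseteq> X ` {1..n} \<union> Y ` {1..n}"
    and deg: "\<And>i. i \<in> {1..n} \<Longrightarrow> Poly_Mapping.lookup m (X i) + Poly_Mapping.lookup m (Y i) = r i"
    using f m by (auto simp: S_piece_def)
  have "wt m = (\<Sum>v\<in>X ` {1..n} \<union> Y ` {1..n}. int (Poly_Mapping.lookup m v) * sg v)"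
    unfolding wt_def using keys by (intro sum.mono_neutral_left) (auto simp: in_keys_iff)
  also have "\<dots> = (\<Sum>v\<in>X ` {1..n}. int (Poly_Mapping.lookup m v) * sg v) +
      (\<Sum>v\<in>Y ` {1..n}. int (Poly_Mapping.lookup m v) * sg v)"
    by (rule sum.union_disjoint) auto
  also have "\<dots> = int (\<Sum>i=1..n. Poly_Mapping.lookup m (X i)) -
      int (\<Sum>i=1..n. Poly_Mapping.lookup m (Y i))"
    by (simp add: sum.reindex inj_on_def sg_def sum_negf)
  finally have "(\<Sum>i=1..n. Poly_Mapping.lookup m (X i)) = (\<Sum>i=1..n. Poly_Mapping.lookup m (Y i))"
    using wt0 by linarith
  moreover have "(\<Sum>i=1..n. r i) =
      (\<Sum>i=1..n. Poly_Mapping.lookup m (X i)) + (\<Sum>i=1..n. Poly_Mapping.lookup m (Y i))"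
    by (simp add: deg flip: sum.distrib)
  ultimately show ?thesis
    by simp
qed

section \<open>Spanning by bracket forms\<close>

interpretation mpoly: vector_space "mscale :: 'k::field \<Rightarrow> ('v, 'k) mpoly \<Rightarrow> ('v, 'k) mpoly"
  by (rule vector_space_mscale)

text \<open>The factor \<open>e\<close> takes the place of a product of brackets, of which only the
  invariance is recorded. The length condition makes the number of coordinates equal to the weight
  |r| - 2B. A list of indices lets a prefix of prescribed length be traded for brackets.\<close>

definition bracket_forms :: "nat \<Rightarrow> (nat \<Rightarrow> nat) \<Rightarrow> nat \<Rightarrow> (coord, 'k::comm_ring_1) mpoly set" where
  "bracket_forms n r B = {e * prod_list (map (\<lambda>i. mvar (X i)) is) | e s is.
     e \<in> bipiece n s B \<and> SL2_invariant e \<and> set is \<subseteq> {1..n} \<and>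
     (\<forall>i\<in>{1..n}. r i = s i + count_list is i) \<and> 2 * B + length is = (\<Sum>i=1..n. r i)}"

lemma bipiece_X_prod_list:
  "set is \<subseteq> {1..n} \<Longrightarrow>
    prod_list (map (\<lambda>i. mvar (X i) :: (coord, 'k::comm_ring_1) mpoly) is) \<in> bipiece n (count_list is) 0"
proof (induction "is")
  case (Cons i "is")
  have "mvar (X i) * prod_list (map (\<lambda>i. mvar (X i) :: (coord, 'k) mpoly) is) \<in>
      bipiece n (\<lambda>j. (if j = i then 1 else 0) + count_list is j) (0 + 0)"
    by (rule bipiece_mult[OF bipiece_X]) (use Cons in auto)
  moreover have "count_list (i # is) = (\<lambda>j. (if j = i then 1 else 0) + count_list is j)"
    by (rule ext) auto
  ultimately show ?case by simp
next
  case Nil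
  have "count_list [] = (\<lambda>i. 0)"
    by (rule ext) simp
  then show ?case by simp
qed

lemma bracket_forms_subset_U_invariants: "bracket_forms n r B \<subseteq> U_invariants n r B"
proof
  fix p :: "(coord, 'a) mpoly" assume "p \<in> bracket_forms n r B"
  then obtain e s "is" where p: "p = e * prod_list (map (\<lambda>i. mvar (X i)) is)"
    and e: "e \<in> bipiece n s B" "SL2_invariant e" and "is": "set is \<subseteq> {1..n}"
    and r: "\<forall>i\<in>{1..n}. r i = s i + count_list is i"
    by (auto simp: bracket_forms_def)
  have "p \<in> bipiece n (\<lambda>i. s i + count_list is i) (B + 0)"
    unfolding p by (rule bipiece_mult[OF e(1) bipiece_X_prod_list[OF "is"]])
  also have "\<dots> = bipiece n r B"
    using r by (auto intro!: bipiece_cong)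
  finally have "p \<in> bipiece n r B" .
  moreover have "meval mconst shear (prod_list (map (\<lambda>i. mvar (X i)) js)) =
      prod_list (map (\<lambda>i. mvar (X i) :: (coord, 'a) mpoly) js)" for js
    by (induction js) (simp_all add: is_hom_1[OF is_hom_meval[OF is_hom_mconst]]
        meval_mult[OF is_hom_mconst] meval_mvar[OF is_hom_mconst] shear_def)
  ultimately show "p \<in> U_invariants n r B"
    by (simp add: U_invariants_def p meval_mult[OF is_hom_mconst] SL2_invariant_shear[OF e(2)])
qed

section \<open>Linear structure and lifting to one more point\<close>

lemma bipiece_subspace: "mpoly.subspace (bipiece n r B :: (coord, 'k::field) mpoly set)"
proof (rule mpoly.subspaceI)
  fix c :: 'k and f :: "(coord, 'k) mpoly" assume "f \<in> bipiece n r B"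
  from bipiece_mult[OF bipiece_mconst[of c] this] show "mscale c f \<in> bipiece n r B"
    by (simp add: mscale_def)
qed (auto simp: bipiece_add)

lemma U_invariants_subspace: "mpoly.subspace (U_invariants n r B :: (coord, 'k::field) mpoly set)"
  using bipiece_subspace[of n r B]
  by (auto simp: mpoly.subspace_def U_invariants_def mscale_def meval_add[OF is_hom_mconst]
      meval_mult[OF is_hom_mconst] meval_mconst[OF is_hom_mconst] is_hom_0[OF is_hom_meval[OF is_hom_mconst]])

lemma bipiece_Suc:
  assumes "f \<in> bipiece n r B"
  shows "f \<in> bipiece (Suc n) (r(Suc n := 0)) B"
proof -
  have eq: "Poly_Mapping.lookup m (X (Suc n)) = 0 \<and> Poly_Mapping.lookup m (Y (Suc n)) = 0"
    if "m \<in> Poly_Mapping.keys f" for m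
  proof -
    have "X (Suc n) \<notin> Poly_Mapping.keys m" "Y (Suc n) \<notin> Poly_Mapping.keys m"
      using that assms by (force simp: bipiece_def S_piece_def)+
    then show ?thesis by (simp add: in_keys_iff)
  qed
  have "f \<in> S_piece (Suc n) (r(Suc n := 0))"
    unfolding S_piece_def
  proof (intro CollectI ballI conjI)
    fix m assume m: "m \<in> Poly_Mapping.keys f"
    show "Poly_Mapping.keys m \<subseteq> X ` {1..Suc n} \<union> Y ` {1..Suc n}"
      using m assms by (force simp: bipiece_def S_piece_def)
    fix i assume "i \<in> {1..Suc n}"
    then show "Poly_Mapping.lookup m (X i) + Poly_Mapping.lookup m (Y i) = (r(Suc n := 0)) i"
      using m assms eq[OF m] by (cases "i = Suc n") (auto simp: bipiece_def S_piece_def)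
  qed
  then show ?thesis
    using assms eq by (simp add: bipiece_def)
qed

lemma bipiece_bracket_prod_list:
  "set is \<subseteq> {1..n} \<Longrightarrow>
    prod_list (map (\<lambda>i. bracket i (Suc n) :: (coord, 'k::comm_ring_1) mpoly) is) \<in>
    bipiece (Suc n) (\<lambda>i. if i = Suc n then length is else count_list is i) (length is)"
proof (induction "is")
  case Nil
  show ?case by (simp cong: if_cong)
next
  case (Cons i "is")
  have 1: "(mvar (X i) :: (coord, 'k) mpoly) * mvar (Y (Suc n)) \<in> bipiece (Suc n)
      (\<lambda>j. (if j = i then 1 else 0) + (if j = Suc n then 1 else 0)) (0 + 1)"
    using Cons by (intro bipiece_mult bipiece_X bipiece_Y) auto
  have 2: "(mvar (Y i) :: (coord, 'k) mpoly) * mvar (X (Suc n)) \<in> bipiece (Suc n)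
      (\<lambda>j. (if j = i then 1 else 0) + (if j = Suc n then 1 else 0)) (1 + 0)"
    using Cons by (intro bipiece_mult bipiece_X bipiece_Y) auto
  have 3: "mconst (- 1 :: 'k) * (mvar (Y i) * mvar (X (Suc n))) \<in> bipiece (Suc n)
      (\<lambda>j. 0 + ((if j = i then 1 else 0) + (if j = Suc n then 1 else 0))) (0 + (1 + 0))"
    by (intro bipiece_mult[OF bipiece_mconst] 2)
  have br: "bracket i (Suc n) = mvar (X i) * mvar (Y (Suc n)) + mconst (- 1 :: 'k) * (mvar (Y i) * mvar (X (Suc n)))"
    by (simp add: bracket_def is_hom_uminus[OF is_hom_mconst] mult.commute)
  have "(bracket i (Suc n) :: (coord, 'k) mpoly) \<in> bipiece (Suc n)
      (\<lambda>j. (if j = i then 1 else 0) + (if j = Suc n then 1 else 0)) 1"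
    unfolding br using bipiece_add[OF 1] 3 by simp
  then have "(bracket i (Suc n) :: (coord, 'k) mpoly) * prod_list (map (\<lambda>i. bracket i (Suc n)) is) \<in> bipiece (Suc n)
      (\<lambda>j. (if j = i then 1 else 0) + (if j = Suc n then 1 else 0) +
        (if j = Suc n then length is else count_list is j)) (1 + length is)"
    using Cons by (intro bipiece_mult) auto
  moreover have "(\<lambda>j. (if j = i then 1 else 0) + (if j = Suc n then 1 else 0) +
        (if j = Suc n then length is else count_list is j)) =
      (\<lambda>j. if j = Suc n then length (i # is) else count_list (i # is) j)"
    using Cons.prems by (intro ext) auto
  ultimately show ?case
    by (simp only: list.map prod_list.Cons) simp
qed

lemma coeff_prod_list_linear:
  fixes c d :: "'a \<Rightarrow> 'b::comm_ring_1"
  shows "coeff (prod_list (map (\<lambda>i. [:c i, d i:]) is)) (length is) = prod_list (map d is)"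
    and "k > length is \<Longrightarrow> coeff (prod_list (map (\<lambda>i. [:c i, d i:]) is)) k = 0"
proof (induction "is" arbitrary: k)
  case (Cons i "is")
  {
    case 1
    show ?case using Cons(2)[of "Suc (length is)"] Cons(1) by simp
  next
    case 2
    then obtain k' where "k = Suc k'" "k' > length is" by (cases k) auto
    then show ?case using Cons(2)[of k] Cons(2)[of k'] by simp
  }
qed auto

text \<open>In \<open>[i N] = x_i y_N - x_N y_i\<close> the coefficient of \<open>y_N\<close> is
  \<open>x_i\<close>. Trading j coordinates for brackets with N = \<open>Suc n\<close> therefore
  gives a form whose coefficient of \<open>y_N ^ j\<close> is the old one and which has no higher
  terms; a power of \<open>x_N\<close> fills up the degree \<open>r_N\<close>.\<close>

lemma bracket_forms_lift:
  fixes p :: "(coord, 'k::comm_ring_1) mpoly"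
  assumes p: "p \<in> bracket_forms n r (B - j)" and j: "j \<le> B" "j \<le> r (Suc n)"
    and B: "2 * B \<le> (\<Sum>i=1..n. r i) + j"
  shows "\<exists>f\<in>bracket_forms (Suc n) r B.
    last_coeff (Suc n) j f = p \<and> (\<forall>b>j. last_coeff (Suc n) b f = 0)"
proof -
  let ?Xs = "\<lambda>is. prod_list (map (\<lambda>i. mvar (X i) :: (coord, 'k) mpoly) is)"
  obtain e s "is" where p: "p = e * ?Xs is"
    and e: "e \<in> bipiece n s (B - j)" "SL2_invariant e" and "is": "set is \<subseteq> {1..n}"
    and r: "\<forall>i\<in>{1..n}. r i = s i + count_list is i"
    and len: "2 * (B - j) + length is = (\<Sum>i=1..n. r i)"
    using p by (auto simp: bracket_forms_def)
  define us where "us = take j is"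
  define vs where "vs = drop j is"
  have "is_eq": "is = us @ vs" and us: "set us \<subseteq> {1..n}" and vs: "set vs \<subseteq> {1..n}"
    using "is" set_take_subset[of j "is"] set_drop_subset[of j "is"] by (auto simp: us_def vs_def)
  \<comment> \<open>There are |r| - 2(B - j) coordinates, and this is at least j exactly when 2B is
    at most |r| + j.\<close>
  have len_us: "length us = j"
    using len B j by (simp add: us_def)
  define q where "q = r (Suc n) - j"
  define Br where "Br = prod_list (map (\<lambda>i. bracket i (Suc n) :: (coord, 'k) mpoly) us)"
  define ws where "ws = vs @ replicate q (Suc n)"
  define f where "f = (e * Br) * ?Xs ws"
  define s' where "s' = (\<lambda>i. (s(Suc n := 0)) i + (if i = Suc n then length us else count_list us i))"
  have vs_N: "count_list vs (Suc n) = 0"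
    using vs by (auto simp: count_list_0_iff)
  have "f \<in> bracket_forms (Suc n) r B"
    unfolding bracket_forms_def
  proof (intro CollectI exI conjI)
    show "f = (e * Br) * ?Xs ws"
      by (rule f_def)
    have "e * Br \<in> bipiece (Suc n) s' (B - j + length us)"
      unfolding s'_def Br_def
      by (intro bipiece_mult bipiece_Suc[OF e(1)] bipiece_bracket_prod_list us)
    then show "e * Br \<in> bipiece (Suc n) s' B"
      using len_us j by simp
    show "SL2_invariant (e * Br)"
      unfolding Br_def by (intro SL2_invariant_mult e SL2_invariant_prod_list SL2_invariant_bracket)
    show "set ws \<subseteq> {1..Suc n}"
      using vs by (force simp: ws_def)
    have count: "count_list (replicate k (Suc n)) i = (if i = Suc n then k else 0)" for i k
      by (induction k) auto
    show "\<forall>i\<in>{1..Suc n}. r i = s' i + count_list ws i"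
    proof
      fix i assume i: "i \<in> {1..Suc n}"
      show "r i = s' i + count_list ws i"
      proof (cases "i = Suc n")
        case True
        then show ?thesis using j vs_N by (simp add: s'_def ws_def len_us q_def count)
      next
        case False
        then show ?thesis using i r by (simp add: s'_def ws_def is_eq count)
      qed
    qed
    have "length is = j + length vs"
      using is_eq len_us by simp
    then show "2 * B + length ws = (\<Sum>i=1..Suc n. r i)"
      using len j by (simp add: ws_def q_def)
  qed
  moreover have "last_coeff (Suc n) b f = (if b = j then p else 0)" if "b \<ge> j" for b
  proof -
    have S: "e * ?Xs vs \<in> S_piece n (\<lambda>i. s i + count_list vs i)"
      using bipiece_mult[OF e(1) bipiece_X_prod_list[OF vs]] by (simp add: bipiece_def)
    have "?Xs (replicate k i) = mvar (X i) ^ k" for k i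
      by (induction k) simp_all
    then have f: "f = (e * ?Xs vs) * (Br * mvar (X (Suc n)) ^ q)"
      by (simp add: f_def ws_def mult_ac)
    have "meval (\<lambda>a. [:mconst a:]) (last_eval (Suc n)) (Br * mvar (X (Suc n)) ^ q) =
        prod_list (map (\<lambda>i. [: - mvar (Y i), mvar (X i):]) us)"
      using us unfolding Br_def
      by (induction us)
        (auto simp: is_hom_simps[OF is_hom_meval[OF is_hom_const_poly_mconst]] bracket_def
          meval_mvar[OF is_hom_const_poly_mconst] last_eval_def)
    then have "last_coeff (Suc n) b (Br * mvar (X (Suc n)) ^ q) =
        coeff (prod_list (map (\<lambda>i. [: - mvar (Y i), mvar (X i):]) us)) b"
      by (simp add: last_coeff_def)
    also have "\<dots> = (if b = j then ?Xs us else 0)"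
      using coeff_prod_list_linear(1)[of "\<lambda>i. - mvar (Y i) :: (coord, 'k) mpoly" "\<lambda>i. mvar (X i)" us]
        coeff_prod_list_linear(2)[of us b "\<lambda>i. - mvar (Y i) :: (coord, 'k) mpoly" "\<lambda>i. mvar (X i)"]
        that len_us by auto
    finally show ?thesis
      unfolding f last_coeff_mult_S_piece[OF S] by (simp add: p is_eq mult_ac)
  qed
  ultimately show ?thesis
    by (intro bexI[of _ f]) auto
qed

lemma span_bracket_forms_lift:
  fixes g :: "(coord, 'k::field) mpoly"
  assumes g: "g \<in> mpoly.span (bracket_forms n r (B - j))" and j: "j \<le> B" "j \<le> r (Suc n)"
    and B: "2 * B \<le> (\<Sum>i=1..n. r i) + j"
  shows "\<exists>f\<in>mpoly.span (bracket_forms (Suc n) r B).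
    last_coeff (Suc n) j f = g \<and> (\<forall>b>j. last_coeff (Suc n) b f = 0)"
  using g
proof (induction rule: mpoly.span_induct_alt)
  case base
  show ?case by (rule bexI[of _ 0]) (auto intro: mpoly.span_zero)
next
  case (step c p g)
  obtain f where f: "f \<in> mpoly.span (bracket_forms (Suc n) r B)"
    "last_coeff (Suc n) j f = g" "\<forall>b>j. last_coeff (Suc n) b f = 0"
    using step by blast
  obtain q where q: "q \<in> bracket_forms (Suc n) r B"
    "last_coeff (Suc n) j q = p" "\<forall>b>j. last_coeff (Suc n) b q = 0"
    using bracket_forms_lift[OF step(1) j B] by blast
  have "mscale c q + f \<in> mpoly.span (bracket_forms (Suc n) r B)"
    by (rule mpoly.span_add[OF mpoly.span_scale[OF mpoly.span_base[OF q(1)]] f(1)])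
  then show ?case
    by (rule bexI[rotated]) (simp add: f q last_coeff_add last_coeff_mscale)
qed

lemma span_bracket_forms_subset: "mpoly.span (bracket_forms n r B) \<subseteq> U_invariants n r B"
  by (rule mpoly.span_minimal[OF bracket_forms_subset_U_invariants U_invariants_subspace])

text \<open>The inner induction is on a strict bound \<open>k\<close> for the degree in
  \<open>y_N\<close>: the top coefficient is a combination of forms in fewer points, its lift has
  the same top term, and subtracting the lift lowers the bound.\<close>

lemma U_invariants_eq_span:
  fixes r :: "nat \<Rightarrow> nat"
  assumes "2 * B \<le> (\<Sum>i=1..n. r i)"
  shows "U_invariants n r B = mpoly.span (bracket_forms n r B :: (coord, 'k::field) mpoly set)"
  using assms
proof (induction n arbitrary: B)
  case 0
  have "f \<in> bracket_forms 0 r B" if "f \<in> bipiece 0 r B" for f :: "(coord, 'k) mpoly"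
  proof -
    from that have "SL2_invariant f"
      by (induction rule: bipiece_induct)
        (simp_all add: mon_def SL2_invariant_mconst SL2_invariant_add SL2_invariant_mconst[of 0, simplified is_hom_0[OF is_hom_mconst]])
    then show ?thesis
      unfolding bracket_forms_def using that 0
      by (intro CollectI exI[of _ f] exI[of _ r] exI[of _ "[]"]) auto
  qed
  then show ?case
    using span_bracket_forms_subset[of 0 r B] mpoly.span_base by (auto simp: U_invariants_def)
next
  case (Suc n)
  have "f \<in> mpoly.span (bracket_forms (Suc n) r B)"
    if "f \<in> U_invariants (Suc n) r B" "\<forall>b\<ge>k. last_coeff (Suc n) b f = 0" "k \<le> Suc (r (Suc n))"
    for k and f :: "(coord, 'k) mpoly"
    using that
  proof (induction k arbitrary: f)
    case 0
    then have "f = 0"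
      using last_coeff_expansion[OF U_invariantsD[OF 0(1)]] by simp
    then show ?case by (simp add: mpoly.span_zero)
  next
    case (Suc k)
    show ?case
    proof (cases "last_coeff (Suc n) k f = 0")
      case True
      then have "\<forall>b\<ge>k. last_coeff (Suc n) b f = 0"
        using Suc.prems(2) by (metis le_antisym not_less_eq_eq)
      then show ?thesis
        using Suc by simp
    next
      case False
      have k: "k \<le> B" "k \<le> r (Suc n)"
        using last_coeff_eq_0[OF U_invariantsD[OF Suc.prems(1)], of k] False by force+
      have top: "last_coeff (Suc n) b f = 0" if "b > k" for b
        using that Suc.prems(2) by simp
      have B: "2 * B \<le> (\<Sum>i=1..n. r i) + k"
        by (rule top_last_coeff_bound[OF Suc.prems(1) k(2) top False])
      have "last_coeff (Suc n) k f \<in> U_invariants n r (B - k)"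
        by (rule top_last_coeff_U_invariant[OF Suc.prems(1) k top])
      \<comment> \<open>The bound 2B \<le> |r| + k gives 2(B - k) \<le> |r|, the hypothesis of the
        outer induction.\<close>
      also have "\<dots> = mpoly.span (bracket_forms n r (B - k))"
        using B k by (intro \<open>\<And>B. 2 * B \<le> (\<Sum>i=1..n. r i) \<Longrightarrow> _\<close>) simp
      finally obtain h where h: "h \<in> mpoly.span (bracket_forms (Suc n) r B)"
        "last_coeff (Suc n) k h = last_coeff (Suc n) k f" "\<forall>b>k. last_coeff (Suc n) b h = 0"
        using span_bracket_forms_lift[OF _ k B] by blast
      have "f - h \<in> U_invariants (Suc n) r B"
        using mpoly.subspace_diff[OF U_invariants_subspace Suc.prems(1)] h
          span_bracket_forms_subset by blast
      moreover have "\<forall>b\<ge>k. last_coeff (Suc n) b (f - h) = 0"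
        using h top by (metis last_coeff_diff diff_self le_neq_implies_less)
      ultimately have "f - h \<in> mpoly.span (bracket_forms (Suc n) r B)"
        using Suc.IH[of "f - h"] Suc.prems(3) by simp
      from mpoly.span_add[OF this h(1)] show ?thesis by simp
    qed
  qed
  from this[where k = "Suc (r (Suc n))"]
  have "f \<in> mpoly.span (bracket_forms (Suc n) r B)" if "f \<in> U_invariants (Suc n) r B"
    for f :: "(coord, 'k) mpoly"
    using that last_coeff_eq_0[OF U_invariantsD[OF that]] by (simp add: Suc_le_eq)
  then show ?case
    using span_bracket_forms_subset by blast
qed

text \<open>At weight zero the length condition leaves no coordinates, and the form is its invariant
  factor \<open>e\<close>.\<close>

lemma SL2_invariant_bracket_forms:
  assumes "2 * B = (\<Sum>i=1..n. r i)" "p \<in> bracket_forms n r B"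
  shows "SL2_invariant p"
  using assms by (auto simp: bracket_forms_def)

text \<open>Invariance under a Borel subgroup already implies invariance under \<open>SL_2\<close>.
  Instead of the completeness of the flag variety, the spanning by bracket forms gives the harder
  inclusion.\<close>

lemma SL2_invariants_eq_U_invariants:
  fixes r :: "nat \<Rightarrow> nat"
  assumes "2 * B = (\<Sum>i=1..n. r i)"
  shows "{f \<in> S_piece n r. SL2_invariant f} = (U_invariants n r B :: (coord, 'k::field) mpoly set)"
proof (intro equalityI subsetI)
  fix f :: "(coord, 'k) mpoly" assume "f \<in> {f \<in> S_piece n r. SL2_invariant f}"
  then have f: "f \<in> S_piece n r" "SL2_invariant f" by auto
  have "(\<Sum>i=1..n. Poly_Mapping.lookup m (Y i)) = B" if "m \<in> Poly_Mapping.keys f" for m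
    using SL2_invariant_torus[OF f(2,1) that] assms by simp
  then show "f \<in> U_invariants n r B"
    using f by (simp add: U_invariants_def bipiece_def SL2_invariant_shear)
next
  fix f :: "(coord, 'k) mpoly" assume f: "f \<in> U_invariants n r B"
  then have "f \<in> mpoly.span (bracket_forms n r B)"
    by (simp add: U_invariants_eq_span assms)
  then have "SL2_invariant f"
  proof (induction rule: mpoly.span_induct_alt)
    case base
    show ?case using SL2_invariant_mconst[of 0] by (simp add: is_hom_0[OF is_hom_mconst])
  next
    case (step c p g)
    show ?case
      unfolding mscale_def
      by (intro SL2_invariant_add SL2_invariant_mult SL2_invariant_mconst
          SL2_invariant_bracket_forms[OF assms] step)
  qed
  then show "f \<in> {f \<in> S_piece n r. SL2_invariant f}"
    using f by (simp add: U_invariants_def bipiece_def)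
qed

lemma SL2_invariants_odd:
  fixes r :: "nat \<Rightarrow> nat"
  assumes "odd (\<Sum>i=1..n. r i)"
  shows "{f \<in> S_piece n r. SL2_invariant f} = {0 :: (coord, 'k::field) mpoly}"
proof -
  have "f = 0" if f: "f \<in> S_piece n r" "SL2_invariant f" for f :: "(coord, 'k) mpoly"
  proof -
    have "Poly_Mapping.keys f = {}"
      using SL2_invariant_torus[OF f(2,1)] assms by (metis dvd_triv_left equals0I)
    then show ?thesis by simp
  qed
  then show ?thesis
    using SL2_invariant_mconst[of 0] by (auto simp: is_hom_0[OF is_hom_mconst])
qed

section \<open>Counting lattice points of a box\<close>

text \<open>\<open>neg_binom k M\<close> is the coefficient of \<open>t ^ M\<close> in \<open>(1 - t) / (1 - t) ^ k\<close>, and \<open>box_coeff k I r B\<close>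
  that of \<open>t ^ B\<close> in \<open>(1 - t) / (1 - t) ^ k * (\<Prod>i\<in>I. (1 - t ^ (r i + 1)) / (1 - t))\<close>. Hence
  \<open>box_coeff 1\<close> counts the points of the box \<open>\<Prod>{0..r i}\<close> with coordinate sum \<open>B\<close>.\<close>

fun neg_binom :: "nat \<Rightarrow> int \<Rightarrow> int" where
  "neg_binom 0 M = (if M = 0 then 1 else if M = 1 then - 1 else 0)"
| "neg_binom (Suc k) M = (if M < 0 then 0 else \<Sum>i\<le>nat M. neg_binom k (int i))"

definition box_coeff :: "nat \<Rightarrow> nat set \<Rightarrow> (nat \<Rightarrow> nat) \<Rightarrow> int \<Rightarrow> int" where
  "box_coeff k I r B =
    (\<Sum>J\<in>Pow I. (- 1) ^ card J * neg_binom (card I + k) (B - int (sum r J) - int (card J)))"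

lemma neg_binom_neg: "M < 0 \<Longrightarrow> neg_binom k M = 0"
  by (cases k) auto

lemma neg_binom_diff: "neg_binom k M = neg_binom (Suc k) M - neg_binom (Suc k) (M - 1)"
proof -
  consider "M < 0" | "M = 0" | m where "M = int (Suc m)"
    by (metis not_less_iff_gr_or_eq pos_int_cases Suc_pred)
  then show ?thesis
    by cases (simp_all add: neg_binom_neg nat_add_distrib)
qed

lemma neg_binom_1: "neg_binom (Suc 0) M = (if M = 0 then 1 else 0)"
proof (cases "M < 0")
  case False
  have "neg_binom (Suc 0) (int m) = (if m = 0 then 1 else 0)" for m
  proof (induction m)
    case (Suc m)
    then show ?case using neg_binom_diff[of 0 "int (Suc m)"] by (auto split: if_splits)
  qed simp
  from this[of "nat M"] False show ?thesis by simp
qed simp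

text \<open>The series is (1 - t) / (1 - t) ^ (k + 2) = 1 / (1 - t) ^ (k + 1). This shift by two is
  the origin of n - 2 in the Hilbert function.\<close>

lemma neg_binom_choose: "neg_binom (Suc (Suc k)) (int m) = int ((m + k) choose k)"
proof (induction k arbitrary: m)
  case 0
  have "neg_binom (Suc (Suc 0)) (int m) = (\<Sum>i\<le>m. neg_binom (Suc 0) (int i))"
    by simp
  also have "\<dots> = (\<Sum>i\<le>m. if i = 0 then 1 else 0)"
    unfolding neg_binom_1 by simp
  finally show ?case by simp
next
  case (Suc k)
  have "neg_binom (Suc (Suc (Suc k))) (int m) = (\<Sum>i\<le>m. neg_binom (Suc (Suc k)) (int i))"
    by simp
  also have "\<dots> = int (\<Sum>i\<le>m. (k + i) choose k)"
    unfolding Suc by (simp add: add.commute)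
  also have "\<dots> = int ((k + m + 1) choose (k + 1))"
    by (simp add: choose_rising_sum)
  finally show ?case by (simp add: add.commute)
qed

declare neg_binom.simps(2) [simp del]

lemma sum_neg_binom:
  "(\<Sum>b\<le>r. neg_binom k (M - int b)) = neg_binom (Suc k) M - neg_binom (Suc k) (M - int r - 1)"
proof (induction r)
  case 0
  show ?case using neg_binom_diff[of k M] by simp
next
  case (Suc r)
  have "M - int (Suc r) = M - int r - 1"
    by simp
  then show ?case
    by (simp only: sum.atMost_Suc Suc neg_binom_diff[of k "M - int r - 1"])
qed

lemma box_coeff_empty: "box_coeff k {} r B = neg_binom k B"
  by (simp add: box_coeff_def)

lemma box_coeff_neg:
  assumes "B < 0"
  shows "box_coeff k I r B = 0"
proof -
  have "B - int (sum r J) - int (card J) < 0" for J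
    using assms by linarith
  then show ?thesis
    by (simp add: box_coeff_def neg_binom_neg)
qed

text \<open>Multiplication by (1 - t ^ (r i + 1)) / (1 - t) = 1 + t + ... + t ^ (r i). Subsets with
  and without \<open>i\<close> are paired, and each pair is a telescoped sum.\<close>

lemma box_coeff_insert:
  assumes "finite I" "i \<notin> I"
  shows "box_coeff k (insert i I) r B = (\<Sum>b\<le>r i. box_coeff k I r (B - int b))"
proof -
  define K where "K = card I + k"
  define M where "M J = B - int (sum r J) - int (card J)" for J
  have J: "finite J" "i \<notin> J" if "J \<in> Pow I" for J
    using that assms finite_subset by auto
  have inj: "inj_on (insert i) (Pow I)"
    using assms(2) by (auto simp: inj_on_def)
  have "box_coeff k (insert i I) r B =
      (\<Sum>J\<in>Pow I \<union> insert i ` Pow I. (- 1) ^ card J * neg_binom (Suc K) (M J))"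
    using assms by (simp add: box_coeff_def Pow_insert K_def M_def)
  also have "\<dots> = (\<Sum>J\<in>Pow I. (- 1) ^ card J * neg_binom (Suc K) (M J)) +
      (\<Sum>J\<in>insert i ` Pow I. (- 1) ^ card J * neg_binom (Suc K) (M J))"
    using assms by (intro sum.union_disjoint) auto
  also have "(\<Sum>J\<in>insert i ` Pow I. (- 1) ^ card J * neg_binom (Suc K) (M J)) =
      (\<Sum>J\<in>Pow I. - ((- 1) ^ card J * neg_binom (Suc K) (M J - int (r i) - 1)))"
    unfolding sum.reindex[OF inj] o_def
  proof (rule sum.cong[OF refl])
    fix J' assume J': "J' \<in> Pow I"
    have "M (insert i J') = M J' - int (r i) - 1"
      using J[OF J'] by (simp add: M_def)
    then show "(- 1) ^ card (insert i J') * neg_binom (Suc K) (M (insert i J')) =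
        - ((- 1) ^ card J' * neg_binom (Suc K) (M J' - int (r i) - 1))"
      using J[OF J'] by simp
  qed
  also have "(\<Sum>J\<in>Pow I. (- 1) ^ card J * neg_binom (Suc K) (M J)) + \<dots> =
      (\<Sum>J\<in>Pow I. (- 1) ^ card J * (\<Sum>b\<le>r i. neg_binom K (M J - int b)))"
    unfolding sum_neg_binom by (simp add: sum.distrib[symmetric] right_diff_distrib)
  also have "\<dots> = (\<Sum>b\<le>r i. \<Sum>J\<in>Pow I. (- 1) ^ card J * neg_binom K (M J - int b))"
    unfolding sum_distrib_left by (rule sum.swap)
  also have "\<dots> = (\<Sum>b\<le>r i. box_coeff k I r (B - int b))"
    by (simp add: box_coeff_def K_def M_def algebra_simps)
  finally show ?thesis .
qed

lemma box_coeff_diff: "box_coeff k I r B = box_coeff (Suc k) I r B - box_coeff (Suc k) I r (B - 1)"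
proof -
  have "neg_binom (card I + k) (B - int (sum r J) - int (card J)) =
      neg_binom (card I + Suc k) (B - int (sum r J) - int (card J)) -
      neg_binom (card I + Suc k) (B - 1 - int (sum r J) - int (card J))" for J
    using neg_binom_diff[of "card I + k" "B - int (sum r J) - int (card J)"]
    by (simp del: neg_binom.simps add: algebra_simps)
  then show ?thesis
    unfolding box_coeff_def sum_subtractf[symmetric] right_diff_distrib[symmetric] by simp
qed

text \<open>The box is invariant under the reflection b \<mapsto> r i - b in every
  coordinate.\<close>

lemma box_coeff_symmetric:
  assumes "finite I"
  shows "box_coeff 1 I r (int (sum r I) - B) = box_coeff 1 I r B"
  using assms
proof (induction I arbitrary: B rule: finite_induct)
  case empty
  show ?case by (simp add: box_coeff_empty neg_binom_1 del: neg_binom.simps)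
next
  case (insert i I)
  have "box_coeff 1 (insert i I) r (int (sum r (insert i I)) - B) =
      (\<Sum>b\<le>r i. box_coeff 1 I r (int (sum r I) - (B - int (r i - b))))"
    unfolding box_coeff_insert[OF insert(1,2)]
    by (rule sum.cong[OF refl]) (use insert(1,2) in \<open>simp add: algebra_simps of_nat_diff\<close>)
  also have "\<dots> = (\<Sum>b\<le>r i. box_coeff 1 I r (B - int (r i - b)))"
    by (simp only: insert.IH)
  also have "\<dots> = (\<Sum>b\<le>r i. box_coeff 1 I r (B - int b))"
    by (rule sum.reindex_bij_witness[of _ "\<lambda>b. r i - b" "\<lambda>b. r i - b"]) auto
  finally show ?case
    by (simp add: box_coeff_insert[OF insert(1,2)])
qed

text \<open>The terms dropped here telescope, and their sum vanishes by symmetry.\<close>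

lemma box_coeff_insert_truncated:
  assumes I: "finite I" "i \<notin> I" and B: "2 * B \<le> int (sum r I) + int (r i)"
  shows "box_coeff 0 (insert i I) r B =
    (\<Sum>b\<in>{b. b \<le> r i \<and> 2 * B \<le> int (sum r I) + int b}. box_coeff 0 I r (B - int b))"
proof -
  \<comment> \<open>The dropped indices are the b < 2B - |r|; \<open>nat\<close> makes their number
    0 if the difference is negative.\<close>
  define m where "m = nat (2 * B - int (sum r I))"
  have split: "{..r i} = {b. b \<le> r i \<and> 2 * B \<le> int (sum r I) + int b} \<union> {..<m}"
    using B by (auto simp: m_def)
  have "box_coeff 0 I r (B - int b) = box_coeff 1 I r (B - int b) - box_coeff 1 I r (B - int (Suc b))"
    for b
  proof -
    have "B - int (Suc b) = B - int b - 1"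
      by simp
    then show ?thesis
      using box_coeff_diff[of 0 I r "B - int b"] by (simp only: One_nat_def)
  qed
  then have "(\<Sum>b<m. box_coeff 0 I r (B - int b)) =
      (\<Sum>b<m. box_coeff 1 I r (B - int b) - box_coeff 1 I r (B - int (Suc b)))"
    by (rule sum.cong[OF refl])
  also have "\<dots> = box_coeff 1 I r B - box_coeff 1 I r (B - int m)"
    by (subst sum_lessThan_telescope') simp
  also have "\<dots> = 0"
  proof (cases "m = 0")
    case False
    \<comment> \<open>The telescoped sum ends at the mirror image of \<open>B\<close>, so its two
      boundary terms agree.\<close>
    then have "B - int m = int (sum r I) - B"
      by (simp add: m_def)
    then show ?thesis
      by (simp only: box_coeff_symmetric[OF I(1)])
  qed simp
  finally have zero: "(\<Sum>b<m. box_coeff 0 I r (B - int b)) = 0" .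
  have "finite {b. b \<le> r i \<and> 2 * B \<le> int (sum r I) + int b}"
    by (rule finite_subset[of _ "{..r i}"]) auto
  moreover have "{b. b \<le> r i \<and> 2 * B \<le> int (sum r I) + int b} \<inter> {..<m} = {}"
    by (auto simp: m_def)
  ultimately show ?thesis
    unfolding box_coeff_insert[OF I] split by (simp add: sum.union_disjoint zero)
qed

text \<open>The layers of a box grow up to the middle one. In the truncated recursion 2(B - b) \<le>
  |r| - b, so every surviving term again lies in the lower half; in the empty box the value -1 at
  \<open>B = 1\<close> is excluded by 2B \<le> 0.\<close>

lemma box_coeff_nonneg:
  assumes "finite I" "2 * B \<le> int (sum r I)"
  shows "box_coeff 0 I r B \<ge> 0"
  using assms
proof (induction I arbitrary: B rule: finite_induct)
  case (insert i I)
  have "2 * B \<le> int (sum r I) + int (r i)"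
    using insert by simp
  from box_coeff_insert_truncated[OF insert(1,2) this] show ?case
    by (auto intro!: sum_nonneg insert.IH)
qed (simp add: box_coeff_empty)

section \<open>Dimensions\<close>

text \<open>The finite basis is kept as a witness, because \<open>dim\<close> is 0 for an
  infinite-dimensional space as well.\<close>

definition (in vector_space) has_basis_card :: "'b set \<Rightarrow> nat \<Rightarrow> bool" where
  "has_basis_card V k \<longleftrightarrow> (\<exists>A. finite A \<and> independent A \<and> span A = V \<and> card A = k)"

lemma (in vector_space) has_basis_card_dim: "has_basis_card V k \<Longrightarrow> dim V = k"
  unfolding has_basis_card_def using dim_span_eq_card_independent by blast

lemma (in vector_space) has_basis_card_0: "has_basis_card {0} 0"
  unfolding has_basis_card_def by (rule exI[of _ "{}"]) (simp add: independent_empty)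

lemma (in vector_space) has_basis_card_rank_nullity:
  assumes V: "subspace V" and add: "\<And>x y. \<phi> (x + y) = \<phi> x + \<phi> y"
    and scale: "\<And>c x. \<phi> (scale c x) = scale c (\<phi> x)"
    and ker: "has_basis_card {v \<in> V. \<phi> v = 0} k" and im: "has_basis_card (\<phi> ` V) l"
  shows "has_basis_card V (k + l)"
proof -
  have zero: "\<phi> 0 = 0"
    using scale[of 0 0] by simp
  have diff: "\<phi> (x - y) = \<phi> x - \<phi> y" for x y
    using add[of "x - y" y] by simp
  have sum: "\<phi> (\<Sum>x\<in>S. f x) = (\<Sum>x\<in>S. \<phi> (f x))" for f :: "'b \<Rightarrow> 'b" and S
    by (induction S rule: infinite_finite_induct) (simp_all add: zero add)
  obtain A where A: "finite A" "independent A" "span A = {v \<in> V. \<phi> v = 0}" "card A = k"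
    using ker by (auto simp: has_basis_card_def)
  obtain C where C: "finite C" "independent C" "span C = \<phi> ` V" "card C = l"
    using im by (auto simp: has_basis_card_def)
  have "\<forall>w\<in>C. \<exists>v\<in>V. \<phi> v = w"
    using span_base C(3) by (metis imageE)
  then obtain h where h: "\<And>w. w \<in> C \<Longrightarrow> h w \<in> V" "\<And>w. w \<in> C \<Longrightarrow> \<phi> (h w) = w"
    by metis
  have A_V: "A \<subseteq> V" "\<And>v. v \<in> A \<Longrightarrow> \<phi> v = 0"
    using A(3) span_base[of _ A] by blast+
  have inj: "inj_on h C"
    using h(2) by (metis inj_onI)
  have disj: "A \<inter> h ` C = {}"
    using A_V(2) h(2) C(2) dependent_zero by fastforce
  have "v \<in> span (A \<union> h ` C)" if v: "v \<in> V" for v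
  proof -
    have lift: "\<exists>u\<in>span (h ` C). \<phi> u = w" if "w \<in> span C" for w
      using that
    proof (induction rule: span_induct_alt)
      case base
      show ?case using span_zero zero by blast
    next
      case (step c x y)
      then obtain u where u: "u \<in> span (h ` C)" "\<phi> u = y" by blast
      have "scale c (h x) + u \<in> span (h ` C)"
        by (intro span_add span_scale u(1)) (use step(1) in \<open>auto intro: span_base\<close>)
      then show ?case
        using u(2) h(2)[OF step(1)] by (intro bexI[of _ "scale c (h x) + u"]) (simp_all add: add scale)
    qed
    obtain u where u: "u \<in> span (h ` C)" "\<phi> u = \<phi> v"
      using lift[of "\<phi> v"] v C(3) by blast
    have "span (h ` C) \<subseteq> V"
      by (rule span_minimal[OF _ V]) (use h in auto)
    then have "v - u \<in> span A"
      using u v subspace_diff[OF V v, of u] by (auto simp: A(3) diff)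
    then have "(v - u) + u \<in> span (A \<union> h ` C)"
      using u(1) span_mono[of A "A \<union> h ` C"] span_mono[of "h ` C" "A \<union> h ` C"]
      by (intro span_add) auto
    then show ?thesis by simp
  qed
  moreover have "span (A \<union> h ` C) \<subseteq> V"
    by (rule span_minimal[OF _ V]) (use h A_V in auto)
  moreover have "independent (A \<union> h ` C)"
  proof (rule independent_if_scalars_zero)
    fix f x assume f: "(\<Sum>x\<in>A \<union> h ` C. scale (f x) x) = 0" and x: "x \<in> A \<union> h ` C"
    have split: "(\<Sum>x\<in>A \<union> h ` C. scale (f x) x) =
        (\<Sum>x\<in>A. scale (f x) x) + (\<Sum>w\<in>C. scale (f (h w)) (h w))"
      using A(1) C(1) disj by (simp add: sum.union_disjoint sum.reindex[OF inj])
    have "(\<Sum>w\<in>C. scale (f (h w)) w) = \<phi> (\<Sum>x\<in>A \<union> h ` C. scale (f x) x)"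
      unfolding split add sum scale using A_V h(2) by simp
    then have "(\<Sum>w\<in>C. scale (f (h w)) w) = 0"
      by (simp add: f zero)
    then have fh: "f (h w) = 0" if "w \<in> C" for w
      using independentD[OF C(2,1) subset_refl, of "\<lambda>w. f (h w)"] that by simp
    then have "(\<Sum>x\<in>A. scale (f x) x) = 0"
      using f unfolding split by simp
    then have "f x = 0" if "x \<in> A" for x
      using independentD[OF A(2,1) subset_refl, of f] that by simp
    then show "f x = 0"
      using x fh by auto
  qed (use A C in auto)
  moreover have "card (A \<union> h ` C) = k + l"
    using A C disj by (simp add: card_Un_disjoint card_image[OF inj])
  ultimately show ?thesis
    unfolding has_basis_card_def using A(1) C(1) by (intro exI[of _ "A \<union> h ` C"]) auto
qed

text \<open>\<open>F k\<close> consists of the invariants of degree below k in \<open>y_N\<close>.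
  By the bound and the lift, the k-th coefficient maps \<open>F (Suc k)\<close> onto all invariants
  of \<open>n\<close> points with \<open>y\<close>-degree B - k, or to 0 when 2B > |r| + k.
  Rank-nullity then adds up exactly the terms of the truncated recursion.\<close>

lemma U_invariants_has_basis_card:
  fixes r :: "nat \<Rightarrow> nat"
  assumes "2 * B \<le> (\<Sum>i=1..n. r i)"
  shows "mpoly.has_basis_card (U_invariants n r B :: (coord, 'k::field) mpoly set)
    (nat (box_coeff 0 {1..n} r (int B)))"
  using assms
proof (induction n arbitrary: B)
  case 0
  have "bipiece 0 r 0 \<subseteq> mpoly.span {1 :: (coord, 'k) mpoly}"
  proof
    fix f :: "(coord, 'k) mpoly" assume "f \<in> bipiece 0 r 0"
    then show "f \<in> mpoly.span {1}"
    proof (induction rule: bipiece_induct)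
      case (mon c a b)
      show ?case
        using mpoly.span_scale[OF mpoly.span_base[of 1 "{1}"], of c]
        by (simp add: mon_def mscale_def[of c 1])
    qed (auto intro: mpoly.span_zero mpoly.span_add)
  qed
  moreover have "bipiece 0 r 0 = (bipiece 0 (\<lambda>i. 0) 0 :: (coord, 'k) mpoly set)"
    by (rule bipiece_cong) simp
  then have "(1 :: (coord, 'k) mpoly) \<in> U_invariants 0 r 0"
    by (simp add: U_invariants_def is_hom_1[OF is_hom_meval[OF is_hom_mconst]])
  then have "mpoly.span {1} \<subseteq> (U_invariants 0 r 0 :: (coord, 'k) mpoly set)"
    by (intro mpoly.span_minimal U_invariants_subspace) auto
  ultimately have "U_invariants 0 r 0 = mpoly.span {1 :: (coord, 'k) mpoly}"
    by (auto simp: U_invariants_def)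
  then show ?case
    using 0 unfolding mpoly.has_basis_card_def
    by (intro exI[of _ "{1}"]) (simp add: box_coeff_empty)
next
  case (Suc n)
  let ?R = "\<Sum>i=1..n. r i" and ?I = "{1..n}"
  define F :: "nat \<Rightarrow> (coord, 'k) mpoly set"
    where "F k = {f \<in> U_invariants (Suc n) r B. \<forall>b\<ge>k. last_coeff (Suc n) b f = 0}" for k
  have F_sub: "mpoly.subspace (F k)" for k
    using U_invariants_subspace[of "Suc n" r B]
    by (auto simp: mpoly.subspace_def F_def last_coeff_add last_coeff_mscale)
  have F_Suc: "{f \<in> F (Suc k). last_coeff (Suc n) k f = 0} = F k" for k
    by (auto simp: F_def Suc_le_eq) (metis le_neq_implies_less)
  have card: "mpoly.has_basis_card (F k)
      (\<Sum>b\<in>{b. b < k \<and> 2 * B \<le> ?R + b}. nat (box_coeff 0 ?I r (int B - int b)))"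
    if "k \<le> Suc (r (Suc n))" for k
    using that
  proof (induction k)
    case 0
    have "f = 0" if "f \<in> F 0" for f
      using that last_coeff_expansion[OF U_invariantsD[of f "Suc n" r B]] by (simp add: F_def)
    then have "F 0 = {0}"
      using mpoly.subspace_0[OF F_sub] by blast
    then show ?case
      using mpoly.has_basis_card_0 by simp
  next
    case (Suc k)
    \<comment> \<open>For k > B the image is zero as well; the formula agrees since the integer B -
      k is then negative.\<close>
    let ?im = "if 2 * B \<le> ?R + k then nat (box_coeff 0 ?I r (int B - int k)) else 0"
    have top: "last_coeff (Suc n) b f = 0" if "f \<in> F (Suc k)" "b > k" for f b
      using that by (simp add: F_def)
    have zero: "last_coeff (Suc n) k ` F (Suc k) = {0}"
      if "\<And>f. f \<in> F (Suc k) \<Longrightarrow> last_coeff (Suc n) k f = 0"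
      using that mpoly.subspace_0[OF F_sub] by force
    have "mpoly.has_basis_card (last_coeff (Suc n) k ` F (Suc k)) ?im"
    proof (cases "k \<le> B \<and> 2 * B \<le> ?R + k")
      case True
      have "last_coeff (Suc n) k ` F (Suc k) = U_invariants n r (B - k)"
      proof (intro equalityI subsetI)
        fix g assume "g \<in> last_coeff (Suc n) k ` F (Suc k)"
        then obtain f where f: "f \<in> F (Suc k)" "g = last_coeff (Suc n) k f" by blast
        then have "f \<in> U_invariants (Suc n) r B"
          by (simp add: F_def)
        from top_last_coeff_U_invariant[OF this _ _ top[OF f(1)]]
        show "g \<in> U_invariants n r (B - k)"
          using True Suc.prems f(2) by simp
      next
        fix g :: "(coord, 'k) mpoly" assume "g \<in> U_invariants n r (B - k)"
        moreover have "2 * (B - k) \<le> ?R"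
          using True by linarith
        ultimately have "g \<in> mpoly.span (bracket_forms n r (B - k))"
          using U_invariants_eq_span by blast
        then obtain f where f: "f \<in> mpoly.span (bracket_forms (Suc n) r B)"
          "last_coeff (Suc n) k f = g" "\<forall>b>k. last_coeff (Suc n) b f = 0"
          using span_bracket_forms_lift[of g n r B k] True Suc.prems by auto
        then have "f \<in> F (Suc k)"
          using subsetD[OF span_bracket_forms_subset f(1)] by (auto simp: F_def)
        then show "g \<in> last_coeff (Suc n) k ` F (Suc k)"
          using f by blast
      qed
      moreover have "mpoly.has_basis_card (U_invariants n r (B - k) :: (coord, 'k) mpoly set)
          (nat (box_coeff 0 ?I r (int (B - k))))"
        by (rule \<open>\<And>B. 2 * B \<le> ?R \<Longrightarrow> _\<close>) (use True in linarith)
      ultimately show ?thesis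
        using True by (simp add: of_nat_diff)
    next
      case False
      have "last_coeff (Suc n) k f = 0" if "f \<in> F (Suc k)" for f
      proof (rule ccontr)
        assume nz: "last_coeff (Suc n) k f \<noteq> 0"
        have f: "f \<in> U_invariants (Suc n) r B"
          using that by (simp add: F_def)
        have "k \<le> B"
          using last_coeff_eq_0[OF U_invariantsD[OF f], of k] nz by force
        moreover have "2 * B \<le> ?R + k"
          using top_last_coeff_bound[OF f _ top[OF that] nz] Suc.prems by simp
        ultimately show False
          using False by simp
      qed
      then have "last_coeff (Suc n) k ` F (Suc k) = {0}"
        by (rule zero)
      moreover have "?im = 0"
        using False by (auto simp: box_coeff_neg)
      ultimately show ?thesis
        using mpoly.has_basis_card_0 by simp
    qed
    moreover have "mpoly.has_basis_card (F k)
      (\<Sum>b\<in>{b. b < k \<and> 2 * B \<le> ?R + b}. nat (box_coeff 0 ?I r (int B - int b)))"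
      using Suc by simp
    ultimately have "mpoly.has_basis_card (F (Suc k))
      ((\<Sum>b\<in>{b. b < k \<and> 2 * B \<le> ?R + b}. nat (box_coeff 0 ?I r (int B - int b))) + ?im)"
      by (intro mpoly.has_basis_card_rank_nullity[OF F_sub, where \<phi> = "last_coeff (Suc n) k"])
        (simp_all add: last_coeff_add last_coeff_mscale F_Suc)
    moreover have "{b. b < Suc k \<and> 2 * B \<le> ?R + b} =
        (if 2 * B \<le> ?R + k then insert k else id) {b. b < k \<and> 2 * B \<le> ?R + b}"
      by (auto simp: less_Suc_eq)
    then have "(\<Sum>b\<in>{b. b < Suc k \<and> 2 * B \<le> ?R + b}. nat (box_coeff 0 ?I r (int B - int b))) =
        (\<Sum>b\<in>{b. b < k \<and> 2 * B \<le> ?R + b}. nat (box_coeff 0 ?I r (int B - int b))) + ?im"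
      by (cases "2 * B \<le> ?R + k") simp_all
    ultimately show ?case
      by (simp only:)
  qed
  have "F (Suc (r (Suc n))) = U_invariants (Suc n) r B"
    using last_coeff_eq_0[OF U_invariantsD[of _ "Suc n" r B]] by (auto simp: F_def Suc_le_eq)
  moreover have "box_coeff 0 {1..Suc n} r (int B) =
      int (\<Sum>b\<in>{b. b < Suc (r (Suc n)) \<and> 2 * B \<le> ?R + b}. nat (box_coeff 0 ?I r (int B - int b)))"
  proof -
    have "{b. b \<le> r (Suc n) \<and> 2 * int B \<le> int ?R + int b} =
        {b. b < Suc (r (Suc n)) \<and> 2 * B \<le> ?R + b}"
      by (intro Collect_cong) linarith
    moreover have "2 * int B \<le> int ?R + int (r (Suc n))"
    proof -
      have "2 * B \<le> ?R + r (Suc n)"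
        using Suc.prems by simp
      then show ?thesis by linarith
    qed
    ultimately have "box_coeff 0 (insert (Suc n) ?I) r (int B) =
      (\<Sum>b\<in>{b. b < Suc (r (Suc n)) \<and> 2 * B \<le> ?R + b}. box_coeff 0 ?I r (int B - int b))"
      using box_coeff_insert_truncated[of ?I "Suc n" "int B" r] by simp
    also have "\<dots> = (\<Sum>b\<in>{b. b < Suc (r (Suc n)) \<and> 2 * B \<le> ?R + b}.
        int (nat (box_coeff 0 ?I r (int B - int b))))"
    proof (rule sum.cong[OF refl])
      fix b assume "b \<in> {b. b < Suc (r (Suc n)) \<and> 2 * B \<le> ?R + b}"
      then have "2 * B \<le> ?R + b"
        by simp
      moreover have "2 * B \<le> c + b \<Longrightarrow> 2 * (int B - int b) \<le> int c" for c
        by presburger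
      ultimately have "2 * (int B - int b) \<le> int ?R"
        by blast
      from box_coeff_nonneg[OF _ this]
      show "box_coeff 0 ?I r (int B - int b) = int (nat (box_coeff 0 ?I r (int B - int b)))"
        by simp
    qed
    also have "insert (Suc n) ?I = {1..Suc n}"
      by auto
    finally show ?thesis by simp
  qed
  ultimately show ?case
    using card[of "Suc (r (Suc n))"] by (simp only: nat_int)
qed

section \<open>The graded pieces as box coefficients\<close>

lemma hilbert_function_eq_box_coeff:
  fixes n :: nat and w :: "nat \<Rightarrow> nat"
  defines "R \<equiv> (R_piece n w :: nat \<Rightarrow> (coord, 'k::field) mpoly set)"
  assumes "2 * B = d * weight w {1..n}"
  shows "int (hilbert_function R d) = box_coeff 0 {1..n} (\<lambda>i. d * w i) (int B)"
proof -
  have B: "2 * B = (\<Sum>i=1..n. d * w i)"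
    using assms(2) by (simp add: weight_def sum_distrib_left)
  have "R d = U_invariants n (\<lambda>i. d * w i) B"
    unfolding R_def R_piece_def by (rule SL2_invariants_eq_U_invariants[OF B])
  then have "hilbert_function R d = nat (box_coeff 0 {1..n} (\<lambda>i. d * w i) (int B))"
    unfolding hilbert_function_def
    using mpoly.has_basis_card_dim[OF U_invariants_has_basis_card[of B "\<lambda>i. d * w i" n]] B by simp
  moreover have "box_coeff 0 {1..n} (\<lambda>i. d * w i) (int B) \<ge> 0"
  proof (rule box_coeff_nonneg)
    show "2 * int B \<le> int (\<Sum>i=1..n. d * w i)"
      using B by linarith
  qed simp
  ultimately show ?thesis by simp
qed

lemma hilbert_function_odd:
  fixes n :: nat and w :: "nat \<Rightarrow> nat"
  defines "R \<equiv> (R_piece n w :: nat \<Rightarrow> (coord, 'k::field) mpoly set)"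
  assumes "odd (d * weight w {1..n})"
  shows "hilbert_function R d = 0"
proof -
  have "odd (\<Sum>i=1..n. d * w i)"
    using assms(2) by (simp add: weight_def flip: sum_distrib_left)
  then have "R d = {0}"
    unfolding R_def R_piece_def by (rule SL2_invariants_odd)
  then show ?thesis
    using mpoly.has_basis_card_dim[OF mpoly.has_basis_card_0] by (simp add: hilbert_function_def)
qed

section \<open>The Hilbert function\<close>

text \<open>For M < 0 the upper argument is less than k, so the convention in \<open>binom\<close>
  gives the same zero as the power series.\<close>

lemma binom_eq_neg_binom: "binom (real_of_int M + real k) k = real_of_int (neg_binom (Suc (Suc k)) M)"
proof (cases "M < 0")
  case False
  then obtain m where M: "M = int m"
    by (metis nonneg_int_cases not_less)
  have "binom (real_of_int M + real k) k = real (m + k) gchoose k"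
    by (simp add: binom_def M)
  then show ?thesis
    by (simp only: M neg_binom_choose of_int_of_nat_eq binomial_gbinomial)
qed (simp add: binom_def neg_binom_neg)

lemma finite_short_subsets [simp]: "finite (short_subsets n w)"
  by (rule finite_subset[of _ "Pow {1..n}"]) (auto simp: short_subsets_def)

text \<open>If the weight of J is at least half the total, then J is nonempty since the total is
  positive, and the argument is at most -|J| < 0. Only short subsets contribute, for d = 0
  too.\<close>

lemma box_coeff_eq_sum_binom:
  assumes n: "n \<ge> 2" and pos: "\<forall>i\<in>{1..n}. w i > 0" and B: "2 * B = d * weight w {1..n}"
  shows "real_of_int (box_coeff 0 {1..n} (\<lambda>i. d * w i) (int B)) =
    (\<Sum>J\<in>short_subsets n w. (- 1) ^ card J *
       binom (real d * (real (weight w {1..n}) / 2 - real (weight w J)) + real n - real (card J) - 2) (n - 2))"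
proof -
  define M where "M J = int B - int (d * weight w J) - int (card J)" for J
  obtain k where k: "n = Suc (Suc k)"
    using n by (metis add_2_eq_Suc le_Suc_ex)
  have B': "real B = real d * (real (weight w {1..n}) / 2)"
    using arg_cong[OF B, of real] by simp
  have "weight w {1..n} > 0"
    unfolding weight_def using n pos by (intro sum_pos) auto
  have "neg_binom n (M J) = 0" if J: "J \<in> Pow {1..n} - short_subsets n w" for J
  proof -
    have "real (weight w {1..n}) / 2 \<le> real (weight w J)"
      using J by (auto simp: short_subsets_def)
    moreover have "J \<noteq> {}"
      using calculation \<open>weight w {1..n} > 0\<close> by (auto simp: weight_def simp del: of_nat_sum)
    then have "card J > 0"
      using J finite_subset[of J "{1..n}"] by (simp add: card_gt_0_iff)
    moreover have "real B \<le> real (d * weight w J)"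
      unfolding B' of_nat_mult using calculation(1) by (intro mult_left_mono) auto
    ultimately have "M J < 0"
      unfolding M_def by linarith
    then show ?thesis by (rule neg_binom_neg)
  qed
  then have "box_coeff 0 {1..n} (\<lambda>i. d * w i) (int B) =
      (\<Sum>J\<in>short_subsets n w. (- 1) ^ card J * neg_binom n (M J))"
    unfolding box_coeff_def
    by (intro sum.mono_neutral_cong_right)
      (auto simp: short_subsets_def M_def weight_def sum_distrib_left)
  also have "real_of_int \<dots> = (\<Sum>J\<in>short_subsets n w. (- 1) ^ card J *
       binom (real_of_int (M J) + real k) k)"
    by (simp add: binom_eq_neg_binom k)
  also have "\<dots> = (\<Sum>J\<in>short_subsets n w. (- 1) ^ card J *
       binom (real d * (real (weight w {1..n}) / 2 - real (weight w J)) + real n - real (card J) - 2) (n - 2))"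
  proof (rule sum.cong[OF refl])
    fix J
    have eq: "real_of_int (M J) + real k =
        real d * (real (weight w {1..n}) / 2 - real (weight w J)) + real n - real (card J) - 2"
      using B' by (simp add: M_def k algebra_simps)
    have "n - 2 = k"
      by (simp add: k)
    then show "(- 1) ^ card J * binom (real_of_int (M J) + real k) k = (- 1) ^ card J *
       binom (real d * (real (weight w {1..n}) / 2 - real (weight w J)) + real n - real (card J) - 2) (n - 2)"
      by (simp only: eq)
  qed
  finally show ?thesis .
qed

section \<open>The Hilbert polynomial\<close>

definition binom_poly :: "nat \<Rightarrow> real \<Rightarrow> real \<Rightarrow> real poly" where
  "binom_poly k s c = smult (1 / fact k) (\<Prod>i<k. [:c - real i, s:])"

lemma poly_binom_poly: "poly (binom_poly k s c) x = (x * s + c) gchoose k"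
  by (simp add: binom_poly_def gbinomial_prod_rev poly_prod atLeast0LessThan algebra_simps)

lemma degree_prod_linear_le: "degree (\<Prod>i<k. [:c i, s i:]) \<le> (k::nat)"
proof -
  have "degree (\<Prod>i<k. [:c i, s i:]) \<le> (\<Sum>i<k. degree [:c i, s i:])"
    using degree_prod_sum_le[of "{..<k}" "\<lambda>i. [:c i, s i:]"] by (simp add: o_def)
  also have "\<dots> \<le> (\<Sum>i<k. 1)"
    by (rule sum_mono) simp
  finally show ?thesis by simp
qed

lemma degree_binom_poly_le: "degree (binom_poly k s c) \<le> k"
  unfolding binom_poly_def using degree_prod_linear_le[of "\<lambda>i. c - real i" "\<lambda>i. s" k]
  by (meson degree_smult_le order_trans)

lemma coeff_prod_linear_top: "coeff (\<Prod>i<k. [:c i, s:]) k = (s::'a::comm_ring_1) ^ k"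
proof (induction k)
  case (Suc k)
  have "coeff (\<Prod>i<k. [:c i, s:]) (Suc k) = 0"
    using degree_prod_linear_le[of c "\<lambda>i. s" k] by (intro coeff_eq_0) simp
  then show ?case using Suc by (simp add: mult.commute)
qed simp

text \<open>One factor gives its constant term and the others give s. This is where the inner sum of
  \<open>degree_formula\<close> comes from.\<close>

lemma coeff_prod_linear_subtop:
  "coeff (\<Prod>i<Suc k. [:c i, s:]) k = (s::'a::comm_ring_1) ^ k * (\<Sum>i<Suc k. c i)"
proof (induction k)
  case (Suc k)
  have "coeff (\<Prod>i<Suc (Suc k). [:c i, s:]) (Suc k) =
      c (Suc k) * coeff (\<Prod>i<Suc k. [:c i, s:]) (Suc k) + s * coeff (\<Prod>i<Suc k. [:c i, s:]) k"
    unfolding prod.lessThan_Suc[of _ "Suc k"] by (simp add: mult.commute)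
  also have "\<dots> = s ^ Suc k * (\<Sum>i<Suc (Suc k). c i)"
    unfolding coeff_prod_linear_top Suc by (simp add: algebra_simps)
  finally show ?case .
qed simp

lemma coeff_binom_poly:
  "coeff (binom_poly (Suc k) s c) k = s ^ k * (\<Sum>i=0..k. c - real i) / fact (Suc k)"
  unfolding binom_poly_def
  by (simp add: coeff_prod_linear_subtop[unfolded lessThan_Suc_atMost] atLeast0AtMost lessThan_Suc_atMost
      del: prod.lessThan_Suc fact_Suc)

text \<open>The argument grows, stays constant or becomes negative according to the sign of s. The
  result is a binomial polynomial, a constant or zero, in each case only for large d in
  general.\<close>

lemma eventually_neg_binom_poly:
  "\<exists>Q. degree Q \<le> k \<and>
    (\<forall>\<^sub>F d in sequentially. real_of_int (neg_binom (Suc (Suc k)) (int d * s - int a)) = poly Q (real d))"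
proof -
  consider "s = 0" | "s < 0" | "s > 0" by linarith
  then show ?thesis
  proof cases
    case 1
    then show ?thesis
      by (intro exI[of _ "[:real_of_int (neg_binom (Suc (Suc k)) (- int a)):]"]) simp
  next
    case 2
    have "real_of_int (neg_binom (Suc (Suc k)) (int d * s - int a)) = poly 0 (real d)" if "d \<ge> 1" for d
    proof -
      have "int d * s < 0"
        using that 2 by (simp add: mult_less_0_iff)
      then have "int d * s - int a < 0"
        by linarith
      then show ?thesis
        by (simp add: neg_binom_neg)
    qed
    then show ?thesis
      by (intro exI[of _ 0]) (auto simp: eventually_sequentially)
  next
    case 3
    have "real_of_int (neg_binom (Suc (Suc k)) (int d * s - int a)) =
        poly (binom_poly k (real_of_int s) (real k - real a)) (real d)" if "d \<ge> a" for d
    proof -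
      have "int d * 1 \<le> int d * s"
        using 3 by (intro mult_left_mono) auto
      then have "int d * s - int a \<ge> 0"
        using that by linarith
      then have "0 \<le> real_of_int (int d * s - int a)"
        by linarith
      then show ?thesis
        unfolding binom_eq_neg_binom[symmetric] binom_def poly_binom_poly
        by (simp add: algebra_simps)
    qed
    then show ?thesis
      by (intro exI[of _ "binom_poly k (real_of_int s) (real k - real a)"] conjI degree_binom_poly_le)
        (auto simp: eventually_sequentially)
  qed
qed

text \<open>The Hilbert function counts lattice points at the centre of symmetry, where only one term of
  the Clebsch--Gordan recursion survives.\<close>

lemma box_coeff_insert_central:
  assumes "finite I" "i \<notin> I" "2 * B = int (sum r I) + int (r i)"
  shows "box_coeff 0 (insert i I) r B = box_coeff 0 I r (B - int (r i))"
proof -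
  have "{b. b \<le> r i \<and> 2 * B \<le> int (sum r I) + int b} = {r i}"
    using assms(3) by auto
  then show ?thesis
    using box_coeff_insert_truncated[OF assms(1,2), of B r] assms(3) by simp
qed

text \<open>Passing to one point fewer replaces summands of degree n - 2 in d by summands of degree
  at most n - 3, so the cancellation of leading terms is built in. The index \<open>i\<close> stays
  free: a point of weight above half the total is removed to show vanishing.\<close>

lemma hilbert_function_central:
  fixes n :: nat and w :: "nat \<Rightarrow> nat"
  defines "R \<equiv> (R_piece n w :: nat \<Rightarrow> (coord, 'k::field) mpoly set)"
  assumes v: "weight w {1..n} = 2 * v" and i: "i \<in> {1..n}"
  shows "int (hilbert_function R d) =
    box_coeff 0 ({1..n} - {i}) (\<lambda>i. d * w i) (int d * (int v - int (w i)))"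
proof -
  have ins: "insert i ({1..n} - {i}) = {1..n}"
    using i by auto
  have "weight w {1..n} = w i + sum w ({1..n} - {i})"
    unfolding weight_def using i by (simp add: sum.remove)
  then have "d * (2 * v) = d * (w i + sum w ({1..n} - {i}))"
    using v by simp
  then have "2 * (d * v) = sum (\<lambda>i. d * w i) ({1..n} - {i}) + d * w i"
    by (simp add: sum_distrib_left distrib_left)
  then have "2 * int (d * v) = int (sum (\<lambda>i. d * w i) ({1..n} - {i})) + int (d * w i)"
    by linarith
  from box_coeff_insert_central[OF _ _ this, unfolded ins]
  have "box_coeff 0 {1..n} (\<lambda>i. d * w i) (int (d * v)) =
      box_coeff 0 ({1..n} - {i}) (\<lambda>i. d * w i) (int (d * v) - int (d * w i))"
    by simp
  moreover have "int (hilbert_function R d) = box_coeff 0 {1..n} (\<lambda>i. d * w i) (int (d * v))"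
    unfolding R_def by (rule hilbert_function_eq_box_coeff) (use v in simp)
  ultimately show ?thesis
    by (simp add: algebra_simps)
qed

lemma hilbert_function_eventually_poly:
  fixes n :: nat and w :: "nat \<Rightarrow> nat"
  defines "R \<equiv> (R_piece n w :: nat \<Rightarrow> (coord, 'k::field) mpoly set)"
  assumes n: "n \<ge> 3" and v: "weight w {1..n} = 2 * v"
  shows "\<exists>Q. degree Q \<le> n - 3 \<and> is_hilbert_polynomial R Q"
proof -
  define I where "I = {1..n} - {n}"
  have card: "card I = Suc (Suc (n - 3))"
    using n by (simp add: I_def)
  define s where "s J = int v - int (w n) - int (weight w J)" for J
  have "\<exists>Q. degree Q \<le> n - 3 \<and> (\<forall>\<^sub>F d in sequentially.
      real_of_int (neg_binom (card I) (int d * s J - int (card J))) = poly Q (real d))" for J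
    unfolding card by (rule eventually_neg_binom_poly)
  then obtain Q where Q: "\<And>J. degree (Q J) \<le> n - 3" "\<And>J. \<forall>\<^sub>F d in sequentially.
      real_of_int (neg_binom (card I) (int d * s J - int (card J))) = poly (Q J) (real d)"
    by metis
  define P where "P = (\<Sum>J\<in>Pow I. smult ((- 1) ^ card J) (Q J))"
  have "\<forall>\<^sub>F d in sequentially. \<forall>J\<in>Pow I.
      real_of_int (neg_binom (card I) (int d * s J - int (card J))) = poly (Q J) (real d)"
    using Q(2) by (intro eventually_ball_finite) (auto simp: I_def)
  then have "is_hilbert_polynomial R P"
    unfolding is_hilbert_polynomial_def
  proof eventually_elim
    case (elim d)
    have "real (hilbert_function R d) = real_of_int (int (hilbert_function R d))"
      by simp
    also have "int (hilbert_function R d) =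
        (\<Sum>J\<in>Pow I. (- 1) ^ card J * neg_binom (card I) (int d * s J - int (card J)))"
      unfolding R_def using n
      by (subst hilbert_function_central[OF v, of n])
        (auto simp: box_coeff_def I_def s_def weight_def algebra_simps sum_distrib_left
          intro!: sum.cong)
    also have "real_of_int \<dots> = poly P (real d)"
      using elim by (simp add: P_def poly_sum)
    finally show ?case .
  qed
  moreover have "degree P \<le> n - 3"
    unfolding P_def by (rule degree_sum_le) (use Q(1) in \<open>auto simp: I_def\<close>)
  ultimately show ?thesis by blast
qed

lemma is_hilbert_polynomial_binom_poly:
  fixes n :: nat and w :: "nat \<Rightarrow> nat"
  defines "R \<equiv> (R_piece n w :: nat \<Rightarrow> (coord, 'k::field) mpoly set)"
  assumes n: "n \<ge> 2" and pos: "\<forall>i\<in>{1..n}. w i > 0" and v: "weight w {1..n} = 2 * v"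
  shows "is_hilbert_polynomial R (\<Sum>J\<in>short_subsets n w. smult ((- 1) ^ card J)
    (binom_poly (n - 2) (real (weight w {1..n}) / 2 - real (weight w J)) (real n - real (card J) - 2)))"
proof -
  have "real (hilbert_function R d) = poly (\<Sum>J\<in>short_subsets n w. smult ((- 1) ^ card J)
    (binom_poly (n - 2) (real (weight w {1..n}) / 2 - real (weight w J)) (real n - real (card J) - 2)))
      (real d)" if d: "d \<ge> n" for d
  proof -
    have "real (hilbert_function R d) = real_of_int (int (hilbert_function R d))"
      by simp
    also have "int (hilbert_function R d) = box_coeff 0 {1..n} (\<lambda>i. d * w i) (int (d * v))"
      unfolding R_def by (rule hilbert_function_eq_box_coeff) (use v in simp)
    also have "real_of_int \<dots> = (\<Sum>J\<in>short_subsets n w. (- 1) ^ card J *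
       binom (real d * (real (weight w {1..n}) / 2 - real (weight w J)) + real n - real (card J) - 2) (n - 2))"
      by (rule box_coeff_eq_sum_binom[OF n pos]) (use v in simp)
    also have "\<dots> = (\<Sum>J\<in>short_subsets n w. (- 1) ^ card J * poly (binom_poly (n - 2)
        (real (weight w {1..n}) / 2 - real (weight w J)) (real n - real (card J) - 2)) (real d))"
    proof (rule sum.cong[OF refl])
      fix J assume J: "J \<in> short_subsets n w"
      have "card J \<le> n"
        using J card_mono[of "{1..n}" J] by (auto simp: short_subsets_def)
      \<comment> \<open>Since the total is even, the positive difference is an integer. Together
        with d \<ge> n this puts the upper argument in the range where \<open>binom\<close> is
        polynomial.\<close>
      have "1 \<le> real (weight w {1..n}) / 2 - real (weight w J)"
        using J v by (auto simp: short_subsets_def)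
      then have "real d * 1 \<le> real d * (real (weight w {1..n}) / 2 - real (weight w J))"
        by (intro mult_left_mono) auto
      then have "real (n - 2) \<le>
          real d * (real (weight w {1..n}) / 2 - real (weight w J)) + real n - real (card J) - 2"
        using d n \<open>card J \<le> n\<close> by linarith
      then show "(- 1) ^ card J * binom (real d * (real (weight w {1..n}) / 2 - real (weight w J)) +
          real n - real (card J) - 2) (n - 2) = (- 1) ^ card J * poly (binom_poly (n - 2)
        (real (weight w {1..n}) / 2 - real (weight w J)) (real n - real (card J) - 2)) (real d)"
        by (simp add: binom_def poly_binom_poly add_diff_eq)
    qed
    finally show ?thesis
      by (simp add: poly_sum)
  qed
  then show ?thesis
    unfolding is_hilbert_polynomial_def eventually_sequentially by blast
qed

text \<open>The coefficient of \<open>d ^ (n - 3)\<close> is the one below the top in each binomial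
  polynomial of degree at most n - 2, and (n - 3)! / (n - 2)! gives the factor 1 / (n - 2).\<close>

lemma coeff_hilbert_polynomial:
  fixes n :: nat and w :: "nat \<Rightarrow> nat"
  defines "R \<equiv> (R_piece n w :: nat \<Rightarrow> (coord, 'k::field) mpoly set)"
  assumes n: "n \<ge> 3" and pos: "\<forall>i\<in>{1..n}. w i > 0" and v: "weight w {1..n} = 2 * v"
  shows "fact (n - 3) * coeff (hilbert_polynomial R) (n - 3) = degree_formula n w"
proof -
  obtain k where k: "n = Suc (Suc (Suc k))"
    using n by (metis Suc_le_D numeral_3_eq_3 Suc_le_mono)
  have "hilbert_polynomial R = (\<Sum>J\<in>short_subsets n w. smult ((- 1) ^ card J)
    (binom_poly (n - 2) (real (weight w {1..n}) / 2 - real (weight w J)) (real n - real (card J) - 2)))"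
    unfolding R_def
    by (rule hilbert_polynomial_eq[OF is_hilbert_polynomial_binom_poly[OF _ pos v]]) (use n in simp)
  then have "coeff (hilbert_polynomial R) (n - 3) = (\<Sum>J\<in>short_subsets n w. (- 1) ^ card J *
      ((real (weight w {1..n}) / 2 - real (weight w J)) ^ k *
        (\<Sum>i=0..k. real n - real (card J) - 2 - real i) / fact (Suc k)))"
    by (simp add: coeff_sum k coeff_binom_poly del: sum.atLeast0_atMost_Suc fact_Suc)
  then have "fact k * coeff (hilbert_polynomial R) (n - 3) = (\<Sum>J\<in>short_subsets n w.
      fact k / fact (Suc k) * ((- 1) ^ card J *
      (real (weight w {1..n}) / 2 - real (weight w J)) ^ k *
        (\<Sum>i=0..k. real n - real (card J) - 2 - real i)))"
    by (simp add: sum_distrib_left mult_ac del: fact_Suc)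
  moreover have "fact k / fact (Suc k) = 1 / (real n - 2)"
  proof -
    have "fact k / fact (Suc k) = 1 / real (Suc k)"
      unfolding fact_Suc by (metis fact_nonzero nonzero_divide_mult_cancel_right)
    then show ?thesis by (simp add: k del: fact_Suc)
  qed
  ultimately show ?thesis
    by (simp add: degree_formula_def k sum_divide_distrib del: fact_Suc)
qed

section \<open>Growth of the Hilbert function\<close>

text \<open>Below both sides, the layers \<open>B\<close> and B - 1 of a rectangle have B + 1 and B
  points: the tensor product of two factors is multiplicity free.\<close>

lemma box_coeff_pair:
  assumes "i \<noteq> j" "0 \<le> B" "B \<le> int (r i)" "B \<le> int (r j)"
  shows "box_coeff 0 {i, j} r B = 1"
proof -
  have 1: "box_coeff 0 {j} r C = neg_binom 1 C - neg_binom 1 (C - int (r j) - 1)" for C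
    using box_coeff_insert[of "{}" j 0 r C] sum_neg_binom[of 0 C "r j"] by (simp add: box_coeff_empty)
  have "B - int b - int (r j) - 1 = (B - int (r j) - 1) - int b" for b
    by simp
  then have "box_coeff 0 {i, j} r B = (\<Sum>b\<le>r i. neg_binom 1 (B - int b)) -
      (\<Sum>b\<le>r i. neg_binom 1 ((B - int (r j) - 1) - int b))"
    using box_coeff_insert[of "{j}" i 0 r B] assms(1) by (simp only: 1 sum_subtractf) simp
  also have "\<dots> = neg_binom (Suc (Suc 0)) B"
    unfolding sum_neg_binom using assms by (simp add: neg_binom_neg)
  also have "\<dots> = 1"
    using neg_binom_choose[of 0 "nat B"] assms(2) by simp
  finally show ?thesis .
qed

text \<open>The condition e \<le> x keeps the interval nonnegative, so no integer point is lost in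
  passing to naturals.\<close>

lemma card_nat_near:
  fixes x e :: real
  assumes "0 \<le> e" "e \<le> x"
  shows "2 * e - 1 \<le> real (card {b::nat. \<bar>real b - x\<bar> \<le> e})"
    and "finite {b::nat. \<bar>real b - x\<bar> \<le> e}"
proof -
  define l u where "l = nat \<lceil>x - e\<rceil>" and "u = nat \<lfloor>x + e\<rfloor>"
  have "real l < x - e + 1" "x + e - 1 < real u"
    using assms unfolding l_def u_def by linarith+
  moreover have "real (Suc u) - real l \<le> real (card {l..u})"
    by simp
  moreover have eq: "{b::nat. \<bar>real b - x\<bar> \<le> e} = {l..u}"
  proof (intro set_eqI iffI)
    fix b assume "b \<in> {b::nat. \<bar>real b - x\<bar> \<le> e}"
    then have "x - e \<le> real b" "real b \<le> x + e"
      by auto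
    then show "b \<in> {l..u}"
      unfolding l_def u_def by (simp add: nat_le_iff le_nat_iff ceiling_le_iff le_floor_iff)
  next
    fix b assume "b \<in> {l..u}"
    then have "\<lceil>x - e\<rceil> \<le> int b" "int b \<le> \<lfloor>x + e\<rfloor>"
      unfolding l_def u_def using assms by (auto simp: nat_le_iff le_nat_iff)
    then show "b \<in> {b::nat. \<bar>real b - x\<bar> \<le> e}"
      by (simp add: ceiling_le_iff le_floor_iff abs_le_iff)
  qed
  ultimately show "2 * e - 1 \<le> real (card {b::nat. \<bar>real b - x\<bar> \<le> e})"
    by simp
  show "finite {b::nat. \<bar>real b - x\<bar> \<le> e}"
    unfolding eq by simp
qed

lemma exists_between_finite:
  fixes L U :: "real set"
  assumes "finite L" "finite U" "L \<noteq> {}" "U \<noteq> {}" "\<And>l u. l \<in> L \<Longrightarrow> u \<in> U \<Longrightarrow> l < u"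
  shows "\<exists>x. (\<forall>l\<in>L. l < x) \<and> (\<forall>u\<in>U. x < u)"
proof -
  have "Max L < Min U"
    using assms by simp
  then obtain x where "Max L < x" "x < Min U"
    using dense by blast
  then show ?thesis
    using assms by (intro exI[of _ x]) auto
qed

text \<open>The conditions on \<open>\<beta>\<close> describe the interior of the support of the limit of
  \<open>box_coeff 0 I (d w) (\<beta> d) / d ^ (card I - 2)\<close>, which is positive there.\<close>

lemma box_coeff_growth:
  fixes w :: "nat \<Rightarrow> nat"
  assumes "card I = Suc (Suc k)" "\<And>i. i \<in> I \<Longrightarrow> w i > 0"
    and "0 < \<beta>" "2 * \<beta> < real (sum w I)" "\<And>i. i \<in> I \<Longrightarrow> \<beta> < real (sum w I) - real (w i)"
  shows "\<exists>\<epsilon>>0. \<exists>d0. \<forall>d\<ge>d0. \<forall>B. \<bar>real_of_int B - \<beta> * real d\<bar> \<le> \<epsilon> * real d \<longrightarrow>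
    (\<epsilon> * real d) ^ k \<le> real_of_int (box_coeff 0 I (\<lambda>i. d * w i) B)"
  using assms
proof (induction k arbitrary: I \<beta>)
  case 0
  then obtain i j where I: "I = {i, j}" "i \<noteq> j"
    by (auto simp: card_2_iff numeral_2_eq_2[symmetric])
  define \<epsilon> where "\<epsilon> = min \<beta> (min (real (w i) - \<beta>) (real (w j) - \<beta>))"
  have "\<beta> < real (w i)" "\<beta> < real (w j)"
    using 0(5)[of i] 0(5)[of j] I by auto
  then have \<epsilon>: "\<epsilon> > 0" "\<epsilon> \<le> \<beta>" "\<epsilon> + \<beta> \<le> real (w i)" "\<epsilon> + \<beta> \<le> real (w j)"
    using 0 by (auto simp: \<epsilon>_def)
  have "box_coeff 0 I (\<lambda>i. d * w i) B = 1" if B: "\<bar>real_of_int B - \<beta> * real d\<bar> \<le> \<epsilon> * real d" for d B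
  proof -
    have "\<epsilon> * real d \<le> \<beta> * real d" "(\<epsilon> + \<beta>) * real d \<le> real (w i) * real d"
      "(\<epsilon> + \<beta>) * real d \<le> real (w j) * real d"
      using \<epsilon> by (auto intro: mult_right_mono)
    then have "0 \<le> real_of_int B" "real_of_int B \<le> real (d * w i)" "real_of_int B \<le> real (d * w j)"
      using B by (auto simp: algebra_simps)
    then show ?thesis
      unfolding I(1) by (intro box_coeff_pair[OF I(2)]) linarith+
  qed
  then show ?case
    using \<epsilon>(1) by (intro exI[of _ \<epsilon>]) auto
next
  case (Suc k)
  have fin: "finite I"
    using Suc.prems(1) card_ge_0_finite by force
  obtain i where i: "i \<in> I"
    using Suc.prems(1) by fastforce
  define I' where "I' = I - {i}"
  have I': "finite I'" "i \<notin> I'" "I = insert i I'" "card I' = Suc (Suc k)"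
    using fin i Suc.prems(1) by (auto simp: I'_def)
  define W where "W = real (sum w I')"
  have W: "real (sum w I) = W + real (w i)"
    using I' by (simp add: W_def)
  have w_lt: "real (w j) < W" if j: "j \<in> I'" for j
  proof -
    have "card (I' - {j}) = Suc k"
      using j I' by simp
    then have "I' - {j} \<noteq> {}"
      by force
    then have "sum w (I' - {j}) > 0"
      using I' Suc.prems(2) by (intro sum_pos) auto
    moreover have "sum w I' = w j + sum w (I' - {j})"
      by (rule sum.remove[OF I'(1) j])
    ultimately show ?thesis
      by (simp add: W_def del: of_nat_sum)
  qed
  have wi: "0 < w i" "\<beta> < W" "2 * \<beta> < W + real (w i)"
    using Suc.prems(2)[OF i] Suc.prems(4) Suc.prems(5)[OF i] W by auto
  have wj: "\<beta> < W + real (w i) - real (w j)" if "j \<in> I'" for j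
    using Suc.prems(5)[of j] that I'(3) W by auto
  \<comment> \<open>\<open>\<gamma>\<close> is the limiting value of b / d for the removed point.
    The bounds say that b stays inside its range and inside the truncation, and that \<beta> -
    \<gamma> satisfies the interior conditions for \<open>I'\<close>.\<close>
  have "\<exists>\<gamma>. (\<forall>l\<in>{0, 2 * \<beta> - W} \<union> (\<lambda>j. \<beta> - W + real (w j)) ` I'. l < \<gamma>) \<and>
      (\<forall>u\<in>{\<beta>, real (w i)}. \<gamma> < u)"
  proof (rule exists_between_finite)
    fix l u assume "l \<in> {0, 2 * \<beta> - W} \<union> (\<lambda>j. \<beta> - W + real (w j)) ` I'" "u \<in> {\<beta>, real (w i)}"
    then show "l < u"
      using Suc.prems(3) wi wj w_lt by force
  qed (use I' in auto)
  then obtain \<gamma> where \<gamma>: "0 < \<gamma>" "2 * \<beta> - W < \<gamma>" "\<And>j. j \<in> I' \<Longrightarrow> \<beta> - W + real (w j) < \<gamma>"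
    "\<gamma> < \<beta>" "\<gamma> < real (w i)"
    by auto
  have "\<exists>\<epsilon>>0. \<exists>d0. \<forall>d\<ge>d0. \<forall>B. \<bar>real_of_int B - (\<beta> - \<gamma>) * real d\<bar> \<le> \<epsilon> * real d \<longrightarrow>
    (\<epsilon> * real d) ^ k \<le> real_of_int (box_coeff 0 I' (\<lambda>i. d * w i) B)"
  proof (rule Suc.IH[OF I'(4)])
    show "2 * (\<beta> - \<gamma>) < real (sum w I')"
      using \<gamma> by (simp add: W_def[symmetric] del: of_nat_sum)
    show "\<beta> - \<gamma> < real (sum w I') - real (w j)" if "j \<in> I'" for j
      using \<gamma>(3)[OF that] by (simp add: W_def[symmetric] del: of_nat_sum)
  qed (use \<gamma> Suc.prems(2) I' in auto)
  then obtain \<epsilon>1 d1 where \<epsilon>1: "\<epsilon>1 > 0" and IH: "\<And>d B. d \<ge> d1 \<Longrightarrow>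
      \<bar>real_of_int B - (\<beta> - \<gamma>) * real d\<bar> \<le> \<epsilon>1 * real d \<Longrightarrow>
      (\<epsilon>1 * real d) ^ k \<le> real_of_int (box_coeff 0 I' (\<lambda>i. d * w i) B)"
    by blast
  \<comment> \<open>If \<open>B\<close> and \<open>b\<close> each deviate by \<epsilon> d, then B -
    b deviates by at most 2 \<epsilon> d and 2B - b by at most 3 \<epsilon> d; hence the divisors 2
    and 3.\<close>
  define \<epsilon> where "\<epsilon> = min (\<epsilon>1 / 2) (min \<gamma> (min (real (w i) - \<gamma>) ((\<gamma> + W - 2 * \<beta>) / 3)))"
  have \<epsilon>: "\<epsilon> > 0" "2 * \<epsilon> \<le> \<epsilon>1" "\<epsilon> \<le> \<gamma>" "\<epsilon> + \<gamma> \<le> real (w i)" "3 * \<epsilon> \<le> \<gamma> + W - 2 * \<beta>"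
  proof -
    show "\<epsilon> > 0"
      using \<epsilon>1 \<gamma> by (simp add: \<epsilon>_def)
    have "\<epsilon> \<le> \<epsilon>1 / 2" "\<epsilon> \<le> \<gamma>" "\<epsilon> \<le> real (w i) - \<gamma>" "\<epsilon> \<le> (\<gamma> + W - 2 * \<beta>) / 3"
      unfolding \<epsilon>_def by linarith+
    then show "2 * \<epsilon> \<le> \<epsilon>1" "\<epsilon> \<le> \<gamma>" "\<epsilon> + \<gamma> \<le> real (w i)" "3 * \<epsilon> \<le> \<gamma> + W - 2 * \<beta>"
      by (simp_all add: field_simps)
  qed
  \<comment> \<open>Ensures \<epsilon> d \<ge> 1, so that the count 2 \<epsilon> d - 1 of admissible
    b is at least \<epsilon> d.\<close>
  define d0 where "d0 = max d1 (nat \<lceil>1 / \<epsilon>\<rceil>)"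
  have "(\<epsilon> * real d) ^ Suc k \<le> real_of_int (box_coeff 0 I (\<lambda>i. d * w i) B)"
    if d: "d \<ge> d0" and B: "\<bar>real_of_int B - \<beta> * real d\<bar> \<le> \<epsilon> * real d" for d B
  proof -
    have "1 / \<epsilon> \<le> real d"
      using d by (simp add: d0_def nat_le_iff ceiling_le_iff)
    then have d\<epsilon>: "1 \<le> \<epsilon> * real d"
      using \<epsilon>(1) by (simp add: field_simps)
    define S where "S = {b::nat. \<bar>real b - \<gamma> * real d\<bar> \<le> \<epsilon> * real d}"
    define T where "T = {b. b \<le> d * w i \<and> 2 * B \<le> int (sum (\<lambda>i. d * w i) I') + int b}"
    have sumI': "real (sum (\<lambda>i. d * w i) I') = W * real d"
      by (simp add: W_def sum_distrib_left mult.commute[of _ "real d"])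
    have scaled: "2 * \<epsilon> * real d \<le> \<epsilon>1 * real d" "\<epsilon> * real d \<le> \<gamma> * real d"
      "(\<epsilon> + \<gamma>) * real d \<le> real (w i) * real d" "3 * \<epsilon> * real d \<le> (\<gamma> + W - 2 * \<beta>) * real d"
      using \<epsilon> by (auto intro: mult_right_mono)
    have card_S: "\<epsilon> * real d \<le> real (card S)" and "finite S"
      using card_nat_near[of "\<epsilon> * real d" "\<gamma> * real d"] scaled(2) \<epsilon>(1) d\<epsilon> by (auto simp: S_def)
    have S_T: "S \<subseteq> T"
    proof
      fix b assume "b \<in> S"
      then have b: "\<bar>real b - \<gamma> * real d\<bar> \<le> \<epsilon> * real d"
        by (simp add: S_def)
      have "real b \<le> real (d * w i)"
        using b scaled(3) by (auto simp: algebra_simps)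
      moreover have "2 * real_of_int B \<le> real (sum (\<lambda>i. d * w i) I') + real b"
        unfolding sumI' using b B scaled(4) by (auto simp: algebra_simps)
      then have "real_of_int (2 * B) \<le> real_of_int (int (sum (\<lambda>i. d * w i) I') + int b)"
        by simp
      then have "2 * B \<le> int (sum (\<lambda>i. d * w i) I') + int b"
        by (simp only: of_int_le_iff)
      ultimately show "b \<in> T"
        unfolding T_def by (simp only: of_nat_le_iff mem_Collect_eq)
    qed
    have "finite T"
      by (rule finite_subset[of _ "{..d * w i}"]) (auto simp: T_def)
    have summand: "(\<epsilon> * real d) ^ k \<le> real_of_int (box_coeff 0 I' (\<lambda>i. d * w i) (B - int b))"
      if "b \<in> S" for b
    proof -
      have b: "\<bar>real b - \<gamma> * real d\<bar> \<le> \<epsilon> * real d"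
        using that by (simp add: S_def)
      have "(\<epsilon> * real d) ^ k \<le> (\<epsilon>1 * real d) ^ k"
        using \<epsilon> by (intro power_mono mult_right_mono) auto
      also have "\<dots> \<le> real_of_int (box_coeff 0 I' (\<lambda>i. d * w i) (B - int b))"
      proof (rule IH)
        show "\<bar>real_of_int (B - int b) - (\<beta> - \<gamma>) * real d\<bar> \<le> \<epsilon>1 * real d"
          using b B scaled(1) by (simp add: algebra_simps)
      qed (use d in \<open>simp add: d0_def\<close>)
      finally show ?thesis .
    qed
    have "(\<epsilon> * real d) ^ Suc k \<le> real (card S) * (\<epsilon> * real d) ^ k"
      using card_S \<epsilon>(1) by (simp add: mult_right_mono)
    also have "\<dots> \<le> (\<Sum>b\<in>S. real_of_int (box_coeff 0 I' (\<lambda>i. d * w i) (B - int b)))"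
      using sum_bounded_below[of S "(\<epsilon> * real d) ^ k"] summand by simp
    also have "\<dots> \<le> (\<Sum>b\<in>T. real_of_int (box_coeff 0 I' (\<lambda>i. d * w i) (B - int b)))"
    proof (rule sum_mono2[OF \<open>finite T\<close> S_T])
      fix b assume "b \<in> T - S"
      then have "2 * (B - int b) \<le> int (sum (\<lambda>i. d * w i) I')"
        unfolding T_def by simp
      then show "0 \<le> real_of_int (box_coeff 0 I' (\<lambda>i. d * w i) (B - int b))"
        using box_coeff_nonneg[OF I'(1)] by simp
    qed
    also have "\<dots> = real_of_int (box_coeff 0 I (\<lambda>i. d * w i) B)"
    proof -
      have "2 * \<beta> * real d \<le> (W + real (w i) - 2 * \<epsilon>) * real d"
        using \<epsilon> by (intro mult_right_mono) auto
      then have "2 * real_of_int B \<le> real (sum (\<lambda>i. d * w i) I') + real (d * w i)"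
        unfolding sumI' using B by (auto simp: algebra_simps)
      then have "real_of_int (2 * B) \<le> real_of_int (int (sum (\<lambda>i. d * w i) I') + int (d * w i))"
        by simp
      then have "2 * B \<le> int (sum (\<lambda>i. d * w i) I') + int (d * w i)"
        by (simp only: of_int_le_iff)
      from box_coeff_insert_truncated[OF I'(1,2) this] show ?thesis
        by (simp add: I'(3) T_def)
    qed
    finally show ?thesis .
  qed
  then show ?case
    using \<epsilon>(1) by blast
qed

section \<open>The exact degree of the Hilbert polynomial\<close>

lemma poly_over_power_tendsto_0:
  fixes p :: "real poly"
  assumes "degree p < m"
  shows "(\<lambda>d. poly p (real d) / real d ^ m) \<longlonglongrightarrow> 0"
proof -
  have "(\<lambda>d. coeff p i * (real d ^ i / real d ^ m)) \<longlonglongrightarrow> coeff p i * 0" if "i \<le> degree p" for i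
  proof (rule tendsto_mult[OF tendsto_const])
    have "\<forall>\<^sub>F d in sequentially. inverse (real d) ^ (m - i) = real d ^ i / real d ^ m"
      using eventually_gt_at_top[of 0]
    proof eventually_elim
      case (elim d)
      have "real d ^ m = real d ^ i * real d ^ (m - i)"
        using that assms by (simp flip: power_add)
      then show ?case using elim by (simp add: field_simps)
    qed
    moreover have "(\<lambda>d. inverse (real d) ^ (m - i)) \<longlonglongrightarrow> 0 ^ (m - i)"
      by (intro tendsto_power lim_inverse_n)
    then have "(\<lambda>d. inverse (real d) ^ (m - i)) \<longlonglongrightarrow> 0"
      using that assms by (simp add: zero_power)
    ultimately show "(\<lambda>d. real d ^ i / real d ^ m) \<longlonglongrightarrow> 0"
      by (rule Lim_transform_eventually[rotated])
  qed
  then have "(\<lambda>d. \<Sum>i\<le>degree p. coeff p i * (real d ^ i / real d ^ m)) \<longlonglongrightarrow> (\<Sum>i\<le>degree p. coeff p i * 0)"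
    by (intro tendsto_sum) auto
  then show ?thesis
    by (simp add: poly_altdef sum_divide_distrib)
qed

text \<open>The central argument d (v - w i) is negative for d \<ge> 1.\<close>

lemma hilbert_polynomial_unstable:
  fixes n :: nat and w :: "nat \<Rightarrow> nat"
  defines "R \<equiv> (R_piece n w :: nat \<Rightarrow> (coord, 'k::field) mpoly set)"
  assumes v: "weight w {1..n} = 2 * v" and i: "i \<in> {1..n}" "v < w i"
  shows "hilbert_polynomial R = 0"
proof (rule hilbert_polynomial_eq)
  have "hilbert_function R d = 0" if "d \<ge> 1" for d
  proof -
    have "int d * (int v - int (w i)) < 0"
      using that i(2) by (simp add: mult_less_0_iff)
    then have "int (hilbert_function R d) = 0"
      unfolding R_def hilbert_function_central[OF v i(1)] by (rule box_coeff_neg)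
    then show ?thesis by simp
  qed
  then show "is_hilbert_polynomial R 0"
    unfolding is_hilbert_polynomial_def by (auto simp: eventually_sequentially)
qed

text \<open>After removal of the last point the centre is at \<beta> d with \<beta> = v - w n. The
  three growth conditions then read w n < v, w n > 0 and w i < v.\<close>

lemma degree_hilbert_polynomial_stable:
  fixes n :: nat and w :: "nat \<Rightarrow> nat"
  defines "R \<equiv> (R_piece n w :: nat \<Rightarrow> (coord, 'k::field) mpoly set)"
  assumes n: "n \<ge> 3" and pos: "\<forall>i\<in>{1..n}. w i > 0" and v: "weight w {1..n} = 2 * v"
    and stable: "\<forall>i\<in>{1..n}. w i < v"
  shows "degree (hilbert_polynomial R) = n - 3"
proof -
  obtain Q where Q: "degree Q \<le> n - 3" "is_hilbert_polynomial R Q"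
    using hilbert_function_eventually_poly[OF n v] unfolding R_def by blast
  define I where "I = {1..n} - {n}"
  define \<beta> where "\<beta> = real v - real (w n)"
  have card: "card I = Suc (Suc (n - 3))"
    using n by (simp add: I_def)
  have "weight w {1..n} = w n + sum w I"
    unfolding weight_def I_def by (rule sum.remove) (use n in auto)
  then have "w n + sum w I = 2 * v"
    using v by simp
  then have W: "real (sum w I) = 2 * real v - real (w n)"
    by linarith
  have "\<exists>\<epsilon>>0. \<exists>d0. \<forall>d\<ge>d0. \<forall>B. \<bar>real_of_int B - \<beta> * real d\<bar> \<le> \<epsilon> * real d \<longrightarrow>
    (\<epsilon> * real d) ^ (n - 3) \<le> real_of_int (box_coeff 0 I (\<lambda>i. d * w i) B)"
  proof (rule box_coeff_growth[OF card])
    show "w i > 0" if "i \<in> I" for i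
      using pos that by (simp add: I_def)
    show "0 < \<beta>"
      using stable n by (simp add: \<beta>_def)
    show "2 * \<beta> < real (sum w I)"
      unfolding W \<beta>_def using pos n by simp
    show "\<beta> < real (sum w I) - real (w i)" if "i \<in> I" for i
      unfolding W \<beta>_def using stable that by (simp add: I_def)
  qed
  then obtain \<epsilon> d0 where \<epsilon>: "\<epsilon> > 0" and growth: "\<And>d B. d \<ge> d0 \<Longrightarrow>
      \<bar>real_of_int B - \<beta> * real d\<bar> \<le> \<epsilon> * real d \<Longrightarrow>
      (\<epsilon> * real d) ^ (n - 3) \<le> real_of_int (box_coeff 0 I (\<lambda>i. d * w i) B)"
    by blast
  have lower: "(\<epsilon> * real d) ^ (n - 3) \<le> real (hilbert_function R d)" if "d \<ge> d0" for d
  proof -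
    have "int (hilbert_function R d) = box_coeff 0 I (\<lambda>i. d * w i) (int d * (int v - int (w n)))"
      unfolding R_def I_def by (rule hilbert_function_central[OF v]) (use n in simp)
    moreover have centre: "real_of_int (int d * (int v - int (w n))) = \<beta> * real d"
      by (simp add: \<beta>_def)
    have "\<bar>real_of_int (int d * (int v - int (w n))) - \<beta> * real d\<bar> \<le> \<epsilon> * real d"
      unfolding centre using \<epsilon> by simp
    from growth[OF that this]
    have "(\<epsilon> * real d) ^ (n - 3) \<le>
        real_of_int (box_coeff 0 I (\<lambda>i. d * w i) (int d * (int v - int (w n))))" .
    ultimately show ?thesis
      by (metis of_int_of_nat_eq)
  qed
  have "\<not> degree Q < n - 3"
  proof
    assume "degree Q < n - 3"
    then have lim: "(\<lambda>d. poly Q (real d) / real d ^ (n - 3)) \<longlonglongrightarrow> 0"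
      by (rule poly_over_power_tendsto_0)
    have "\<forall>\<^sub>F d in sequentially. \<epsilon> ^ (n - 3) \<le> poly Q (real d) / real d ^ (n - 3)"
      using Q(2) eventually_ge_at_top[of d0] eventually_gt_at_top[of 0]
      unfolding is_hilbert_polynomial_def
    proof eventually_elim
      case (elim d)
      then show ?case
        using lower[of d] by (simp add: power_mult_distrib pos_le_divide_eq)
    qed
    then have "\<epsilon> ^ (n - 3) \<le> 0"
      by (rule tendsto_lowerbound[OF lim]) simp
    moreover have "\<epsilon> ^ (n - 3) > 0"
      using \<epsilon> by simp
    ultimately show False by simp
  qed
  then show ?thesis
    using Q hilbert_polynomial_eq[OF Q(2)] by simp
qed

text \<open>For n \<ge> 4 a weight equal to half the total has to be excluded from the last claim:
  the central argument is then 0, so h(d) = 1 for all d and \<open>projective_degree\<close> is 1,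
  whereas the coefficient of \<open>d ^ (n - 3)\<close> is 0. For n = 3 that coefficient is the
  constant term and no conflict arises.\<close>

theorem theorem1p1:
  fixes n :: nat and w :: "nat \<Rightarrow> nat"
  defines "R \<equiv> (R_piece n w :: nat \<Rightarrow> (coord, 'k::field) mpoly set)"
  assumes "n \<ge> 2" and "\<forall>i\<in>{1..n}. w i > 0"
  shows "(\<forall>d. even (d * weight w {1..n}) \<longrightarrow>
            real (hilbert_function R d) =
              (\<Sum>J\<in>short_subsets n w. (- 1) ^ card J *
                 binom (real d * (real (weight w {1..n}) / 2 - real (weight w J))
                          + real n - real (card J) - 2) (n - 2))) \<and>
         (\<forall>d. odd (d * weight w {1..n}) \<longrightarrow> hilbert_function R d = 0) \<and>
         (n \<ge> 3 \<and> even (weight w {1..n}) \<longrightarrow>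
            fact (n - 3) * coeff (hilbert_polynomial R) (n - 3) = degree_formula n w \<and>
            (n = 3 \<or> (\<forall>i\<in>{1..n}. 2 * w i \<noteq> weight w {1..n}) \<longrightarrow>
               projective_degree R = degree_formula n w))"
proof (intro conjI allI impI)
  fix d assume "even (d * weight w {1..n})"
  then obtain B where B: "2 * B = d * weight w {1..n}"
    by (metis dvdE)
  have "real (hilbert_function R d) = real_of_int (int (hilbert_function R d))"
    by simp
  also have "int (hilbert_function R d) = box_coeff 0 {1..n} (\<lambda>i. d * w i) (int B)"
    unfolding R_def by (rule hilbert_function_eq_box_coeff[OF B])
  finally show "real (hilbert_function R d) =
      (\<Sum>J\<in>short_subsets n w. (- 1) ^ card J *
         binom (real d * (real (weight w {1..n}) / 2 - real (weight w J))
                  + real n - real (card J) - 2) (n - 2))"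
    by (simp only: box_coeff_eq_sum_binom[OF assms(2,3) B])
next
  fix d assume "odd (d * weight w {1..n})"
  then show "hilbert_function R d = 0"
    unfolding R_def by (rule hilbert_function_odd)
next
  assume "3 \<le> n \<and> even (weight w {1..n})"
  then obtain v where n: "3 \<le> n" and v: "weight w {1..n} = 2 * v"
    by (auto elim: evenE)
  show "fact (n - 3) * coeff (hilbert_polynomial R) (n - 3) = degree_formula n w"
    unfolding R_def by (rule coeff_hilbert_polynomial[OF n assms(3) v])
next
  assume "3 \<le> n \<and> even (weight w {1..n})"
    and generic: "n = 3 \<or> (\<forall>i\<in>{1..n}. 2 * w i \<noteq> weight w {1..n})"
  then obtain v where n: "3 \<le> n" and v: "weight w {1..n} = 2 * v"
    by (auto elim: evenE)
  let ?P = "hilbert_polynomial R"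
  have coeff: "fact (n - 3) * coeff ?P (n - 3) = degree_formula n w"
    unfolding R_def by (rule coeff_hilbert_polynomial[OF n assms(3) v])
  \<comment> \<open>In the first alternative both sides vanish; in the second the coefficient of
    \<open>d ^ (n - 3)\<close> is the leading one.\<close>
  have "?P = 0 \<or> degree ?P = n - 3"
  proof (cases "n = 3")
    case True
    obtain Q where "degree Q \<le> n - 3" "is_hilbert_polynomial R Q"
      using hilbert_function_eventually_poly[OF n v] unfolding R_def by blast
    then show ?thesis
      using hilbert_polynomial_eq[of R Q] True by simp
  next
    case False
    show ?thesis
    proof (cases "\<exists>i\<in>{1..n}. v < w i")
      case True
      then show ?thesis
        unfolding R_def using hilbert_polynomial_unstable[OF v] by blast
    next
      case notless: False
      have "\<forall>i\<in>{1..n}. w i < v"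
      proof
        fix i assume i: "i \<in> {1..n}"
        then have "2 * w i \<noteq> 2 * v"
          using generic False v by metis
        then show "w i < v"
          using notless i by force
      qed
      then show ?thesis
        unfolding R_def using degree_hilbert_polynomial_stable[OF n assms(3) v] by blast
    qed
  qed
  then show "projective_degree R = degree_formula n w"
    using coeff unfolding projective_degree_def by auto
qed

end
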